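(* There exist a set $D$ with $|D| = 3$ and a relation $R \subseteq D^4$ such that, as $n \to \infty$, $$\mathrm{CL}(R, n) \ge \Omega(n^3) \qquad\text{and}\qquad \mathrm{NRD}(R,n) \le \frac{n^3}{2^{\Omega(\log^*(n))}}.$$ That is, there exist constants $c_1, c_2 > 0$ and $n_0$ such that for all integers $n \ge n_0$, $\mathrm{CL}(R,n) \ge c_1 n^3$ and $\mathrm{NRD}(R,n) \le n^3 / 2^{c_2 \log^*(n)}$.
   Context: Given a relation $R \subseteq D^r$ over a finite domain $D$, an instance of $\mathrm{CSP}(R)$ is a pair $(V, C)$ with $V$ a finite set of variables (typically $V = [n] = \{1,\dots,n\}$) and $C \subseteq V^r$ a set of constraints. For an assignment $\varphi : V \to D$ and $S = (v_1,\dots,v_r) \in C$, write $\varphi(S) := (\varphi(v_1),\dots,\varphi(v_r))$; the constraint $S$ is satisfied by $\varphi$ if $\varphi(S) \in R$. An instance on variables $[n]$ with constraints $S_1,\dots,S_m$ is non-redundant if for each $i \in [m]$ there is an assignment $\varphi_i : [n] \to D$ with $\varphi_i(S_i) \notin R$ and $\varphi_i(S_j) \in R$ for all $j \in [m]$ with $j \neq i$. $\mathrm{NRD}(R,n)$ is the maximum $m$ such that there is a non-redundant instance of $\mathrm{CSP}(R)$ with $n$ variables and $m$ constraints. An instance on variables $[n]$ with an ordered list of constraints $S_1,\dots,S_m$ is a valid witness to chain length if for each $i \in [m]$ there is an assignment $\varphi_i : [n] \to D$ with $\varphi_i(S_i) \notin R$ and $\varphi_i(S_j) \in R$ for all $j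 < i$. $\mathrm{CL}(R,n)$ is the maximum $m$ such that there is an instance of $\mathrm{CSP}(R)$ with $n$ variables and $m$ constraints that is a valid witness to chain length. $\log^*(n)$ is the iterated logarithm: the number of times $\log_2$ must be applied to $n$ before the result is at most $1$. *)

theory Defs
  imports Complex_Main "HOL-Library.FuncSet" "HOL-Library.NList"
begin

text \<open>
  Tuples are lists of fixed length: \<open>D\<^sup>r\<close> is \<open>nlists r D\<close>, and the image of a
  constraint scope \<open>S\<close> under an assignment \<open>\<phi>\<close> is \<open>map \<phi> S\<close>.  An assignment is an
  element of \<open>V \<rightarrow> D\<close>; its values outside \<open>V\<close> play no role.
  Neither the domain \<open>D\<close> nor the arity \<open>r\<close> can be recovered from the set \<open>R\<close>,
  so both are explicit parameters.
\<close>

definition csp_instance :: "nat \<Rightarrow> 'v set \<Rightarrow> 'v list set \<Rightarrow> bool" where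
  "csp_instance r V C \<longleftrightarrow> finite V \<and> C \<subseteq> nlists r V"

definition satisfies :: "'d list set \<Rightarrow> ('v \<Rightarrow> 'd) \<Rightarrow> 'v list \<Rightarrow> bool" where
  "satisfies R \<phi> S \<longleftrightarrow> map \<phi> S \<in> R"

definition non_redundant ::
  "'d set \<Rightarrow> nat \<Rightarrow> 'd list set \<Rightarrow> 'v set \<Rightarrow> 'v list set \<Rightarrow> bool" where
  "non_redundant D r R V C \<longleftrightarrow>
     csp_instance r V C \<and>
     (\<forall>S\<in>C. \<exists>\<phi>\<in>V \<rightarrow> D. \<not> satisfies R \<phi> S \<and> (\<forall>T\<in>C. T \<noteq> S \<longrightarrow> satisfies R \<phi> T))"

text \<open>
  The list \<open>Ss\<close> need not be assumed distinct: an entry that repeats an earlier one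
  would have to be both satisfied and violated.
\<close>

definition chain_witness ::
  "'d set \<Rightarrow> nat \<Rightarrow> 'd list set \<Rightarrow> 'v set \<Rightarrow> 'v list list \<Rightarrow> bool" where
  "chain_witness D r R V Ss \<longleftrightarrow>
     csp_instance r V (set Ss) \<and>
     (\<forall>i<length Ss. \<exists>\<phi>\<in>V \<rightarrow> D.
        \<not> satisfies R \<phi> (Ss ! i) \<and> (\<forall>j<i. satisfies R \<phi> (Ss ! j)))"

definition NRD :: "'d set \<Rightarrow> nat \<Rightarrow> 'd list set \<Rightarrow> nat \<Rightarrow> nat" where
  "NRD D r R n = Max {card C | C. non_redundant D r R {1..n} C}"

definition CL :: "'d set \<Rightarrow> nat \<Rightarrow> 'd list set \<Rightarrow> nat \<Rightarrow> nat" where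
  "CL D r R n = Max {length Ss | Ss. chain_witness D r R {1..n} Ss}"

definition log_star :: "real \<Rightarrow> nat" where
  "log_star x = (LEAST k. (log 2 ^^ k) x \<le> 1)"

text \<open>The two maxima and the minimum above are taken over nonempty sets, the former finite.\<close>

lemma finite_nlists:
  assumes "finite A"
  shows "finite (nlists r A)"
proof -
  have "nlists r A = {xs. set xs \<subseteq> A \<and> length xs = r}"
    unfolding nlists_def by blast
  then show ?thesis
    using finite_lists_length_eq[OF assms] by simp
qed

lemma NRD_set_finite: "finite {card C | C. non_redundant D r R {1..n::nat} C}"
proof -
  note fin = finite_nlists[OF finite_atLeastAtMost, of r 1 n]
  have "{card C | C. non_redundant D r R {1..n} C} \<subseteq> card ` Pow (nlists r {1..n})"
    unfolding non_redundant_def csp_instance_def by blast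
  then show ?thesis
    by (rule finite_subset) (intro finite_imageI finite_Pow_iff[THEN iffD2] fin)
qed

lemma NRD_set_nonempty: "{card C | C. non_redundant D r R {1..n::nat} C} \<noteq> {}"
proof -
  have "non_redundant D r R {1..n} {}"
    by (simp add: non_redundant_def csp_instance_def)
  then show ?thesis by blast
qed

lemma chain_witness_distinct:
  assumes "chain_witness D r R V Ss"
  shows "distinct Ss"
proof -
  have neq: "Ss ! i \<noteq> Ss ! j" if ij: "j < i" "i < length Ss" for i j
  proof -
    obtain \<phi> where "\<not> satisfies R \<phi> (Ss ! i)" "\<forall>j<i. satisfies R \<phi> (Ss ! j)"
      using assms ij unfolding chain_witness_def by blast
    then show ?thesis using ij by auto
  qed
  then show ?thesis
    unfolding distinct_conv_nth
  proof (intro allI impI notI)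
    fix i j assume "i < length Ss" "j < length Ss" "i \<noteq> j" "Ss ! i = Ss ! j"
    then show False using neq[of i j] neq[of j i] by (cases "i < j") auto
  qed
qed

lemma CL_set_finite: "finite {length Ss | Ss. chain_witness D r R {1..n::nat} Ss}"
proof -
  note fin = finite_nlists[OF finite_atLeastAtMost, of r 1 n]
  have "length Ss \<le> card (nlists r {1..n})" if w: "chain_witness D r R {1..n} Ss" for Ss
  proof -
    have "set Ss \<subseteq> nlists r {1..n}"
      using w by (simp only: chain_witness_def csp_instance_def)
    then have "card (set Ss) \<le> card (nlists r {1..n})"
      by (rule card_mono[OF fin])
    then show ?thesis
      by (simp only: distinct_card[OF chain_witness_distinct[OF w]])
  qed
  then have "{length Ss | Ss. chain_witness D r R {1..n} Ss} \<subseteq> {..card (nlists r {1..n})}"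
    by blast
  then show ?thesis
    by (rule finite_subset) (rule finite_atMost)
qed

lemma CL_set_nonempty: "{length Ss | Ss. chain_witness D r R {1..n::nat} Ss} \<noteq> {}"
proof -
  have "chain_witness D r R {1..n} []"
    by (simp add: chain_witness_def csp_instance_def)
  then show ?thesis by blast
qed

lemma log_star_exists: "\<exists>k. (log 2 ^^ k) x \<le> 1"
proof -
  have "\<forall>x. x \<le> real m \<longrightarrow> (\<exists>k. (log 2 ^^ k) x \<le> 1)" for m
  proof (induction m)
    case 0
    then show ?case by (intro allI impI exI[of _ 0]) simp
  next
    case (Suc m)
    show ?case
    proof (intro allI impI)
      fix x assume x: "x \<le> real (Suc m)"
      show "\<exists>k. (log 2 ^^ k) x \<le> 1"
      proof (cases "x \<le> 1")
        case True
        then show ?thesis by (intro exI[of _ 0]) simp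
      next
        case False
        show ?thesis
        proof (cases "x \<le> 2")
          case True
          then show ?thesis using False by (intro exI[of _ 1]) simp
        next
          case x2: False
          have "real (Suc m) \<le> 2 ^ m"
            using Suc_leI[OF less_exp[of m]] by (simp only: of_nat_le_numeral_power_cancel_iff)
          then have "x \<le> 2 ^ m" using x by linarith
          then have "log 2 x \<le> real m"
            using False log_le_iff[of 2 x "real m"] powr_realpow[of 2 m] by auto
          then obtain k where "(log 2 ^^ k) (log 2 x) \<le> 1"
            using Suc.IH by blast
          then show ?thesis by (intro exI[of _ "Suc k"]) (simp only: funpow_Suc_right o_apply)
        qed
      qed
    qed
  qed
  moreover obtain m where "x \<le> real m"
    using real_arch_simple by blast
  ultimately show ?thesis by blast
qed

end

theory Submission
  imports Defs
begin

text \<open>A chain witness need satisfy only earlier constraints, and the relation exploits this.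
  Let \<open>(x, y, w, z)\<close> be violated with all values 0. Then a satisfied
  \<open>(x, y', w', z)\<close> forces the value 1 on \<open>y'\<close>, and a satisfied
  \<open>(x', y', w, z)\<close> forces the value 2. When the third coordinate is the sum of the
  first two, the former constraint comes earlier exactly if \<open>y' < y\<close> and the latter
  exactly if \<open>y' > y\<close>, as then \<open>x' < x\<close>. A chain thus never meets both
  demands. In a non-redundant instance order is irrelevant, the demands clash, and the absence of
  this clash is the triangle condition. The logarithm in the energy is what makes the saving
  exponential in \<open>log_star\<close>. A mean-square energy gains an amount that shrinks with the
  density, so the tower height would be polynomial in the inverse density and the saving only
  polynomial in \<open>log_star\<close>. The logarithm sees relative sparsity: if a constant
  fraction of a pair is sparser than the pair by a constant factor, the gain is proportional to the
  number of edges in the pair, whatever its density.\<close>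

text \<open>The relation \<open>R\<close> consists of the value patterns that the constraints \<open>(x, y, x + y, z)\<close>,
  ordered lexicographically by \<open>(x, y, z)\<close>, show relative to a later constraint of the same form;
  hence \<open>CL\<close> is cubic. In a non-redundant instance, group the constraints by the values their
  witnesses take on them. Every group is sparse for one of three reasons: two coordinates determine
  the constraint, or the slices are \<open>C\<^sub>4\<close>-free bipartite graphs, or, for the value \<open>(0, 0, 0, 0)\<close>,
  the slices of fixed \<open>z\<close> are Ruzsa--Szemeredi systems: linear triple systems in which every
  triangle formed by pairs of triples is itself a triple.

  The bound for such systems follows Fox's proof of the removal lemma. With the energy
  \<open>\<Sum> ln d\<close>, summed over the edges, where \<open>d\<close> is the density of the pair of parts containing the
  edge, a partition can be refined, at exponential cost, so that the energy grows by a constant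
  times the number of triples. For a system of density \<open>\<epsilon>\<close> the energy is initially at least
  \<open>-O(log (1/\<epsilon>))\<close> per triple and never positive, so that a tower of height \<open>O(log (1/\<epsilon>))\<close>
  suffices.\<close>

section \<open>Energy of a partition\<close>

text \<open>A partition encoded by the map from an element to its block, so that block sums become
  sums over elements. Values outside \<open>E\<close> are unconstrained.\<close>

definition cell_map :: "'a set \<Rightarrow> ('a \<Rightarrow> 'a set) \<Rightarrow> bool" where
  "cell_map E Q \<longleftrightarrow> (\<forall>e\<in>E. e \<in> Q e \<and> Q e \<subseteq> E \<and> (\<forall>g\<in>Q e. Q g = Q e))"

definition cell_density :: "'a set \<Rightarrow> ('a \<Rightarrow> 'a set) \<Rightarrow> 'a \<Rightarrow> real" where
  "cell_density G Q e = real (card (G \<inter> Q e)) / real (card (Q e))"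

lemma cell_map_sym:
  assumes "cell_map E Q" "e \<in> E" "g \<in> E"
  shows "g \<in> Q e \<longleftrightarrow> e \<in> Q g"
  using assms unfolding cell_map_def by metis

lemma cell_density_le_1:
  assumes "cell_map E Q" "finite E" "e \<in> E"
  shows "cell_density G Q e \<le> 1"
proof -
  have "finite (Q e)" using assms by (metis cell_map_def finite_subset)
  then have "card (G \<inter> Q e) \<le> card (Q e)" by (intro card_mono) auto
  then show ?thesis unfolding cell_density_def by (cases "card (Q e) = 0") (auto simp: divide_le_eq_1)
qed

lemma cell_density_nonneg: "cell_density G Q e \<ge> 0"
  unfolding cell_density_def by simp

lemma cell_density_pos:
  assumes "cell_map E Q" "finite E" "G \<subseteq> E" "e \<in> G"
  shows "cell_density G Q e > 0"
proof -
  have e: "e \<in> G \<inter> Q e" "Q e \<subseteq> E" using assms unfolding cell_map_def by blast+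
  then have "finite (Q e)" using assms finite_subset by blast
  then have "card (G \<inter> Q e) > 0" "card (Q e) > 0"
    using e by (auto simp: card_gt_0_iff)
  then show ?thesis unfolding cell_density_def by simp
qed

text \<open>Double counting over cells: \<open>card Q\<close> elements of weight
  \<open>W * card (G \<inter> Q) / card Q\<close> amount to \<open>W\<close> for each edge in the
  cell \<open>Q\<close>.\<close>

lemma sum_cell_density:
  fixes W :: "'a \<Rightarrow> real"
  assumes Q: "cell_map E Q" and fin: "finite E" and GE: "G \<subseteq> E"
    and W: "\<And>e g. e \<in> E \<Longrightarrow> g \<in> Q e \<Longrightarrow> W g = W e"
  shows "(\<Sum>e\<in>E. W e * cell_density G Q e) = (\<Sum>e\<in>G. W e)"
proof -
  have finG: "finite G" using GE fin finite_subset by blast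
  have QE: "e \<in> Q e" "Q e \<subseteq> E" "g \<in> Q e \<Longrightarrow> Q g = Q e" if "e \<in> E" for e g
    using Q that unfolding cell_map_def by blast+
  have "(\<Sum>e\<in>E. W e * cell_density G Q e) = (\<Sum>e\<in>E. \<Sum>g\<in>G. if g \<in> Q e then W e / real (card (Q e)) else 0)"
  proof (rule sum.cong[OF refl])
    fix e assume e: "e \<in> E"
    have "(\<Sum>g\<in>G. if g \<in> Q e then W e / real (card (Q e)) else 0)
        = (\<Sum>g\<in>G \<inter> Q e. W e / real (card (Q e)))"
      by (simp only: sum.inter_restrict[OF finG])
    then show "W e * cell_density G Q e
        = (\<Sum>g\<in>G. if g \<in> Q e then W e / real (card (Q e)) else 0)"
      by (simp add: cell_density_def)
  qed
  also have "\<dots> = (\<Sum>g\<in>G. \<Sum>e\<in>E. if g \<in> Q e then W e / real (card (Q e)) else 0)"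
    by (rule sum.swap)
  also have "\<dots> = (\<Sum>g\<in>G. W g)"
  proof (rule sum.cong[OF refl])
    fix g assume g: "g \<in> G"
    then have gE: "g \<in> E" using GE by blast
    have "(\<Sum>e\<in>E. if g \<in> Q e then W e / real (card (Q e)) else 0)
        = (\<Sum>e\<in>E. if e \<in> Q g then W g / real (card (Q g)) else 0)"
    proof (rule sum.cong[OF refl])
      fix e assume e: "e \<in> E"
      show "(if g \<in> Q e then W e / real (card (Q e)) else 0)
          = (if e \<in> Q g then W g / real (card (Q g)) else 0)"
        using cell_map_sym[OF Q e gE] W[OF gE, of e] QE(3)[OF gE, of e] by auto
    qed
    also have "\<dots> = (\<Sum>e\<in>E \<inter> Q g. W g / real (card (Q g)))"
      by (simp only: sum.inter_restrict[OF fin])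
    also have "E \<inter> Q g = Q g" using QE(2)[OF gE] by blast
    also have "(\<Sum>e\<in>Q g. W g / real (card (Q g))) = W g"
    proof -
      have "finite (Q g)" "g \<in> Q g" using QE[OF gE] fin finite_subset by blast+
      then have "card (Q g) > 0" by (auto simp: card_gt_0_iff)
      then show ?thesis by simp
    qed
    finally show "(\<Sum>e\<in>E. if g \<in> Q e then W e / real (card (Q e)) else 0) = W g" .
  qed
  finally show ?thesis .
qed

text \<open>In a cell \<open>Q\<close> that meets \<open>G\<close>, each of the
  \<open>card (G \<inter> Q)\<close> edges carries \<open>W * card Q / card (G \<inter> Q)\<close>,
  in total \<open>W\<close> per element. It is only an inequality because cells without edges count
  on the right alone.\<close>

lemma sum_inverse_cell_density:
  fixes W :: "'a \<Rightarrow> real"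
  assumes Q: "cell_map E Q" and fin: "finite E" and GE: "G \<subseteq> E"
    and W: "\<And>e g. e \<in> E \<Longrightarrow> g \<in> Q e \<Longrightarrow> W g = W e"
    and nonneg: "\<And>e. e \<in> E \<Longrightarrow> W e \<ge> 0"
  shows "(\<Sum>e\<in>G. W e / cell_density G Q e) \<le> (\<Sum>e\<in>E. W e)"
proof -
  have finG: "finite G" using GE fin finite_subset by blast
  have QE: "e \<in> Q e" "Q e \<subseteq> E" "g \<in> Q e \<Longrightarrow> Q g = Q e" if "e \<in> E" for e g
    using Q that unfolding cell_map_def by blast+
  have "(\<Sum>g\<in>G. W g / cell_density G Q g)
      = (\<Sum>g\<in>G. \<Sum>e\<in>E. if g \<in> Q e then W e / real (card (G \<inter> Q e)) else 0)"
  proof (rule sum.cong[OF refl])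
    fix g assume g: "g \<in> G"
    then have gE: "g \<in> E" using GE by blast
    have "(\<Sum>e\<in>E. if g \<in> Q e then W e / real (card (G \<inter> Q e)) else 0)
        = (\<Sum>e\<in>E. if e \<in> Q g then W g / real (card (G \<inter> Q g)) else 0)"
    proof (rule sum.cong[OF refl])
      fix e assume e: "e \<in> E"
      show "(if g \<in> Q e then W e / real (card (G \<inter> Q e)) else 0)
          = (if e \<in> Q g then W g / real (card (G \<inter> Q g)) else 0)"
        using cell_map_sym[OF Q e gE] W[OF gE, of e] QE(3)[OF gE, of e] by auto
    qed
    also have "\<dots> = (\<Sum>e\<in>E \<inter> Q g. W g / real (card (G \<inter> Q g)))"
      by (simp only: sum.inter_restrict[OF fin])
    also have "E \<inter> Q g = Q g" using QE(2)[OF gE] by blast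
    finally show "W g / cell_density G Q g
        = (\<Sum>e\<in>E. if g \<in> Q e then W e / real (card (G \<inter> Q e)) else 0)"
      by (simp add: cell_density_def)
  qed
  also have "\<dots> = (\<Sum>e\<in>E. \<Sum>g\<in>G. if g \<in> Q e then W e / real (card (G \<inter> Q e)) else 0)"
    by (rule sum.swap)
  also have "\<dots> \<le> (\<Sum>e\<in>E. W e)"
  proof (rule sum_mono)
    fix e assume e: "e \<in> E"
    have "(\<Sum>g\<in>G. if g \<in> Q e then W e / real (card (G \<inter> Q e)) else 0)
        = (\<Sum>g\<in>G \<inter> Q e. W e / real (card (G \<inter> Q e)))"
      by (simp only: sum.inter_restrict[OF finG])
    also have "\<dots> \<le> W e"
      using nonneg[OF e] by (cases "card (G \<inter> Q e) = 0") auto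
    finally show "(\<Sum>g\<in>G. if g \<in> Q e then W e / real (card (G \<inter> Q e)) else 0) \<le> W e" .
  qed
  finally show ?thesis .
qed

text \<open>Up to scaling by \<open>card G\<close> and an additive constant, this is the relative
  entropy of the cell of a random edge against the cell of a random element of
  \<open>E\<close>.\<close>

definition log_energy :: "'a set \<Rightarrow> ('a \<Rightarrow> 'a set) \<Rightarrow> real" where
  "log_energy G Q = (\<Sum>e\<in>G. ln (cell_density G Q e))"

lemma log_energy_nonpos:
  assumes "cell_map E Q" "finite E" "G \<subseteq> E"
  shows "log_energy G Q \<le> 0"
  unfolding log_energy_def
proof (rule sum_nonpos)
  fix e assume e: "e \<in> G"
  have "cell_density G Q e > 0" "cell_density G Q e \<le> 1"
    using cell_density_pos[OF assms e] cell_density_le_1[OF assms(1,2), of e G] e assms(3) by auto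
  then show "ln (cell_density G Q e) \<le> 0" by simp
qed

text \<open>A variational bound: \<open>W\<close> is a guess for the ratio of new to old density,
  one half on \<open>I\<close> and 1 elsewhere, and \<open>ln t \<le> t - 1\<close> is applied at
  \<open>t = W * d / d'\<close>, where \<open>d\<close> and \<open>d'\<close> are the old and new
  densities. The gain is positive as soon as \<open>G\<close> has on \<open>I\<close> only an eighth
  of the edges that the old densities predict.\<close>

lemma log_energy_gain:
  assumes Q: "cell_map E Q" and Q': "cell_map E Q'" and fin: "finite E" and GE: "G \<subseteq> E"
    and ref: "\<And>e. e \<in> E \<Longrightarrow> Q' e \<subseteq> Q e"
    and IE: "I \<subseteq> E" and I: "\<And>e g. e \<in> I \<Longrightarrow> g \<in> Q' e \<Longrightarrow> g \<in> I"
  shows "log_energy G Q' - log_energy G Q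
           \<ge> (\<Sum>e\<in>I. cell_density G Q e) / 2 - ln 2 * real (card (G \<inter> I))"
proof -
  define W :: "'a \<Rightarrow> real" where "W = (\<lambda>e. if e \<in> I then 1/2 else 1)"
  have finG: "finite G" using GE fin finite_subset by blast
  let ?d = "cell_density G Q" and ?d' = "cell_density G Q'"
  have dconst: "?d g = ?d e" if "e \<in> E" "g \<in> Q' e" for e g
  proof -
    have "g \<in> Q e" using ref that by blast
    then have "Q g = Q e" using Q that(1) unfolding cell_map_def by blast
    then show ?thesis by (simp add: cell_density_def)
  qed
  have Wconst: "W g = W e" if "e \<in> E" "g \<in> Q' e" for e g
  proof -
    have "g \<in> E" "e \<in> Q' g" using that Q' unfolding cell_map_def by blast+
    then show ?thesis using that I unfolding W_def by metis
  qed
  have step: "ln (?d' e) - ln (?d e) \<ge> ln (W e) + 1 - (W e * ?d e) / ?d' e" if e: "e \<in> G" for e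
  proof -
    have p: "?d e > 0" "?d' e > 0" "W e > 0"
      using cell_density_pos[OF Q fin GE e] cell_density_pos[OF Q' fin GE e] by (auto simp: W_def)
    have "ln (W e * ?d e / ?d' e) \<le> W e * ?d e / ?d' e - 1"
      using p by (intro ln_le_minus_one) auto
    moreover have "ln (W e * ?d e / ?d' e) = ln (W e) + ln (?d e) - ln (?d' e)"
      using p by (simp add: ln_mult ln_div)
    ultimately show ?thesis by linarith
  qed
  have "(\<Sum>e\<in>G. ln (W e) + 1 - (W e * ?d e) / ?d' e) \<le> log_energy G Q' - log_energy G Q"
    unfolding log_energy_def sum_subtractf[symmetric] using step by (intro sum_mono) auto
  moreover have "(\<Sum>e\<in>G. ln (W e) + 1 - (W e * ?d e) / ?d' e)
      = (\<Sum>e\<in>G. ln (W e)) + real (card G) - (\<Sum>e\<in>G. (W e * ?d e) / ?d' e)"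
    by (simp add: sum_subtractf sum.distrib)
  moreover have "(\<Sum>e\<in>G. (W e * ?d e) / ?d' e) \<le> (\<Sum>e\<in>E. W e * ?d e)"
    by (rule sum_inverse_cell_density[OF Q' fin GE])
       (auto simp: dconst Wconst cell_density_nonneg, simp add: W_def cell_density_nonneg)
  moreover have "(\<Sum>e\<in>E. W e * ?d e) = (\<Sum>e\<in>E. ?d e) - (\<Sum>e\<in>I. ?d e) / 2"
  proof -
    have "(\<Sum>e\<in>E. W e * ?d e) = (\<Sum>e\<in>E. ?d e - (if e \<in> I then ?d e / 2 else 0))"
      by (intro sum.cong) (auto simp: W_def)
    also have "\<dots> = (\<Sum>e\<in>E. ?d e) - (\<Sum>e\<in>E \<inter> I. ?d e / 2)"
      by (simp add: sum_subtractf sum.inter_restrict[OF fin])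
    also have "E \<inter> I = I" using IE by blast
    finally show ?thesis by (simp add: sum_divide_distrib)
  qed
  moreover have "(\<Sum>e\<in>E. ?d e) = real (card G)"
    using sum_cell_density[OF Q fin GE, of "\<lambda>_. 1"] by simp
  moreover have "(\<Sum>e\<in>G. ln (W e)) = - ln 2 * real (card (G \<inter> I))"
  proof -
    have "(\<Sum>e\<in>G. ln (W e)) = (\<Sum>e\<in>G. if e \<in> I then - ln 2 else 0)"
      by (intro sum.cong) (auto simp: W_def ln_div)
    also have "\<dots> = (\<Sum>e\<in>G \<inter> I. - ln 2)"
      by (simp only: sum.inter_restrict[OF finG])
    finally show ?thesis by simp
  qed
  ultimately show ?thesis by linarith
qed

section \<open>Shattered pairs\<close>

definition edge_density :: "('a \<times> 'b) set \<Rightarrow> 'a set \<Rightarrow> 'b set \<Rightarrow> real" where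
  "edge_density G A B = real (card (G \<inter> A \<times> B)) / (real (card A) * real (card B))"

text \<open>The long clause says that \<open>I\<close> is a union of products of atoms of
  \<open>\<S>\<close>, so adding \<open>\<S>\<close> to a partition makes \<open>I\<close> a union
  of cells. The factor 8 makes \<open>1/2 - ln 2 / 8\<close> positive in
  \<open>log_energy_gain\<close>; the factor 16 is the loss in the worst case of
  \<open>shattered_triple\<close>.\<close>

definition shattered :: "nat \<Rightarrow> ('a \<times> 'a) set \<Rightarrow> 'a set \<Rightarrow> 'a set \<Rightarrow> bool" where
  "shattered K G A B \<longleftrightarrow> (\<exists>\<S> I. finite \<S> \<and> card \<S> \<le> K \<and> I \<subseteq> A \<times> B \<and>
     (\<forall>a a' b b'. (a, b) \<in> I \<longrightarrow> a' \<in> A \<longrightarrow> b' \<in> B \<longrightarrow>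
        (\<forall>S\<in>\<S>. a' \<in> S \<longleftrightarrow> a \<in> S) \<longrightarrow> (\<forall>S\<in>\<S>. b' \<in> S \<longleftrightarrow> b \<in> S) \<longrightarrow> (a', b') \<in> I) \<and>
     card A * card B \<le> 16 * card I \<and>
     8 * real (card (G \<inter> I)) \<le> edge_density G A B * real (card I))"

section \<open>Double counting and covering by few vertices\<close>

lemma card_pairs_by_snd:
  assumes "finite B" "finite C"
  shows "card {p \<in> B \<times> C. P (fst p) (snd p)} = (\<Sum>c\<in>C. card {b\<in>B. P b c})"
proof -
  have "{p \<in> B \<times> C. P (fst p) (snd p)} = prod.swap ` (SIGMA c:C. {b\<in>B. P b c})"
    by force
  then have "card {p \<in> B \<times> C. P (fst p) (snd p)} = card (SIGMA c:C. {b\<in>B. P b c})"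
    by (simp add: card_image inj_on_def prod.swap_def prod_eq_iff)
  also have "\<dots> = (\<Sum>c\<in>C. card {b\<in>B. P b c})"
    using assms by (intro card_SigmaI) auto
  finally show ?thesis .
qed

lemma card_pairs_by_fst:
  assumes "finite B" "finite C"
  shows "card {p \<in> B \<times> C. P (fst p) (snd p)} = (\<Sum>b\<in>B. card {c\<in>C. P b c})"
proof -
  have "{p \<in> B \<times> C. P (fst p) (snd p)} = (SIGMA b:B. {c\<in>C. P b c})"
    by force
  also have "card \<dots> = (\<Sum>b\<in>B. card {c\<in>C. P b c})"
    using assms by (intro card_SigmaI) auto
  finally show ?thesis .
qed

text \<open>By averaging, some \<open>a\<close> is related to at least the fraction
  \<open>\<delta>\<close> of the elements still uncovered; each round adds such an
  \<open>a\<close>.\<close>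

lemma greedy_cover:
  fixes \<delta> :: real
  assumes fin: "finite A" "finite U" "A \<noteq> {}" and \<delta>: "\<delta> \<le> 1"
    and many: "\<And>u. u \<in> U \<Longrightarrow> \<delta> * card A \<le> card {a\<in>A. R a u}"
  shows "\<exists>A'\<subseteq>A. card A' \<le> k \<and> card {u\<in>U. \<not> (\<exists>a\<in>A'. R a u)} \<le> (1 - \<delta>) ^ k * card U"
proof (induction k)
  case 0
  show ?case by (intro exI[of _ "{}"]) auto
next
  case (Suc k)
  then obtain A' where A': "A' \<subseteq> A" "card A' \<le> k"
    "card {u\<in>U. \<not> (\<exists>a\<in>A'. R a u)} \<le> (1 - \<delta>) ^ k * card U" by blast
  define U1 where "U1 = {u\<in>U. \<not> (\<exists>a\<in>A'. R a u)}"
  have finU1: "finite U1" using fin by (simp add: U1_def)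
  have "\<exists>a\<in>A. \<delta> * card U1 \<le> card {u\<in>U1. R a u}"
  proof (rule ccontr)
    assume "\<not> ?thesis"
    then have lt: "\<And>a. a \<in> A \<Longrightarrow> real (card {u\<in>U1. R a u}) < \<delta> * card U1" by force
    have "(\<Sum>a\<in>A. real (card {u\<in>U1. R a u})) < (\<Sum>a\<in>A. \<delta> * card U1)"
      using fin lt by (intro sum_strict_mono) auto
    also have "\<dots> = (\<Sum>u\<in>U1. \<delta> * card A)" by simp
    also have "\<dots> \<le> (\<Sum>u\<in>U1. real (card {a\<in>A. R a u}))"
      using many by (intro sum_mono) (auto simp: U1_def)
    also have "\<dots> = (\<Sum>a\<in>A. real (card {u\<in>U1. R a u}))"
      using card_pairs_by_snd[OF fin(1) finU1, of R] card_pairs_by_fst[OF fin(1) finU1, of R]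
      unfolding of_nat_sum[symmetric] by simp
    finally show False by simp
  qed
  then obtain a where a: "a \<in> A" "\<delta> * card U1 \<le> card {u\<in>U1. R a u}" by blast
  have "{u\<in>U. \<not> (\<exists>a\<in>insert a A'. R a u)} = U1 - {u\<in>U1. R a u}"
    by (auto simp: U1_def)
  moreover have "card (U1 - {u\<in>U1. R a u}) = card U1 - card {u\<in>U1. R a u}"
    using finU1 by (intro card_Diff_subset) auto
  moreover have "card {u\<in>U1. R a u} \<le> card U1"
    using finU1 by (intro card_mono) auto
  ultimately have "real (card {u\<in>U. \<not> (\<exists>a\<in>insert a A'. R a u)})
      = real (card U1) - real (card {u\<in>U1. R a u})"
    by simp
  also have "\<dots> \<le> (1 - \<delta>) * card U1" using a(2) by (simp add: algebra_simps)
  also have "\<dots> \<le> (1 - \<delta>) * ((1 - \<delta>) ^ k * card U)"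
    using A'(3) \<delta> unfolding U1_def[symmetric] by (intro mult_left_mono) auto
  finally have "real (card {u\<in>U. \<not> (\<exists>a\<in>insert a A'. R a u)}) \<le> (1 - \<delta>) ^ Suc k * card U"
    by simp
  moreover have "card (insert a A') \<le> Suc k"
    using A'(2) card_insert_le_m1[of "Suc k" A' a] by simp
  ultimately show ?case using a(1) A'(1) by (intro exI[of _ "insert a A'"]) auto
qed

text \<open>After \<open>1 / \<delta>\<close> greedy rounds at most the fraction
  \<open>exp (-1)\<close>, less than one half, is uncovered.\<close>

lemma half_cover:
  fixes \<delta> :: real
  assumes fin: "finite A" "finite U" "A \<noteq> {}" and \<delta>: "\<delta> \<le> 1" "1 \<le> \<delta> * real k"
    and many: "\<And>u. u \<in> U \<Longrightarrow> \<delta> * card A \<le> card {a\<in>A. R a u}"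
  obtains A' where "A' \<subseteq> A" "card A' \<le> k" "card U \<le> 2 * card {u\<in>U. \<exists>a\<in>A'. R a u}"
proof -
  obtain A' where A': "A' \<subseteq> A" "card A' \<le> k"
    "card {u\<in>U. \<not> (\<exists>a\<in>A'. R a u)} \<le> (1 - \<delta>) ^ k * card U"
    using greedy_cover[OF fin \<delta>(1), of R k] many by blast
  have "(1 - \<delta>) ^ k \<le> exp (- \<delta>) ^ k"
    using \<delta>(1) exp_ge_add_one_self[of "- \<delta>"] by (intro power_mono) auto
  also have "\<dots> = exp (- (\<delta> * real k))"
    by (simp add: exp_of_nat_mult[symmetric] mult.commute)
  also have "\<dots> \<le> exp (- 1)" using \<delta> by simp
  also have "\<dots> \<le> 1 / 2"
    using exp_ge_add_one_self[of 1] by (simp add: exp_minus field_simps)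
  finally have "(1 - \<delta>) ^ k * card U \<le> 1 / 2 * card U"
    by (intro mult_right_mono) auto
  then have "2 * card {u\<in>U. \<not> (\<exists>a\<in>A'. R a u)} \<le> card U" using A'(3) by linarith
  moreover have "card U = card {u\<in>U. \<exists>a\<in>A'. R a u} + card {u\<in>U. \<not> (\<exists>a\<in>A'. R a u)}"
    using fin by (subst card_Un_disjoint[symmetric]) (auto intro!: arg_cong[of _ _ card])
  ultimately show ?thesis using that[of A'] A' by linarith
qed

text \<open>The vertex sets \<open>A\<close>, \<open>B\<close>, \<open>C\<close> are dense in each other but span few triangles.
  If many pairs \<open>(b, c)\<close> have large codegree into \<open>A\<close>, then boundedly many products of
  neighbourhoods of vertices \<open>a\<close> cover much of \<open>B \<times> C\<close>, and such products contain few edges.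
  Otherwise boundedly many products of the neighbourhood of some \<open>c\<close> with the set of vertices of
  small codegree with \<open>c\<close> cover much of \<open>A \<times> B\<close>, unless the degrees from \<open>A\<close> into \<open>C\<close> are
  very uneven, and in that case the pair \<open>(A, C)\<close> is shattered trivially.\<close>

lemma shattered_triple:
  fixes G :: "('a \<times> 'a) set" and j :: nat
  assumes fin: "finite A" "finite B" "finite C"
    and tri: "\<And>a b c c'. \<lbrakk>(a, b) \<in> G; (a, c) \<in> G; (b, c) \<in> G; (a, c') \<in> G; (b, c') \<in> G\<rbrakk> \<Longrightarrow> c = c'"
    and dAB: "1 / 2 ^ j \<le> edge_density G A B"
    and dAC: "1 / 2 ^ j \<le> edge_density G A C"
    and dBC: "1 / 2 ^ j \<le> edge_density G B C"
    and C: "2 ^ (3 * j + 19) \<le> card C"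
  shows "shattered (2 ^ (2 * j + 13)) G A B \<or> shattered (2 ^ (2 * j + 13)) G A C
           \<or> shattered (2 ^ (2 * j + 13)) G B C"
proof -
  have dpos: "(0::real) < 1 / 2 ^ j" by simp
  have cpos: "card A > 0" "card B > 0" "card C > 0"
  proof -
    have "edge_density G A B \<noteq> 0" "edge_density G A C \<noteq> 0" using dpos dAB dAC by linarith+
    then show "card A > 0" "card B > 0" "card C > 0"
      by (auto simp: edge_density_def intro!: gr0I)
  qed
  have ne: "A \<noteq> {}" "C \<noteq> {}" using cpos by auto
  \<comment> \<open>The exponent is dictated by the last case: \<open>2 ^ (j + 6)\<close> vertices
    \<open>c\<close>, each contributing at most \<open>\<delta> * card A * card B\<close> edges,
    give \<open>card A * card B / 2 ^ (j + 7)\<close>. This is at most an eighth of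
    \<open>card I / 2 ^ j\<close>, as \<open>card A * card B \<le> 16 * card I\<close>.\<close>
  define \<delta> :: real where "\<delta> = 1 / 2 ^ (2 * j + 13)"
  define heavy where "heavy = (\<lambda>b c. \<delta> * card A \<le> card {a\<in>A. (a, b) \<in> G \<and> (a, c) \<in> G})"
  define Ch where "Ch = {c\<in>C. card B \<le> 2 * card {b\<in>B. heavy b c}}"
  define Cl where "Cl = C - Ch"
  have finCh: "finite Ch" "finite Cl" using fin by (auto simp: Ch_def Cl_def)
  have CC: "card C = card Ch + card Cl"
    using fin by (simp add: Cl_def Ch_def card_Diff_subset card_mono)
  consider (1) "card C \<le> 2 * card Ch" | (2) "card C \<le> 2 * card Cl" using CC by linarith
  then show ?thesis
  proof cases
    case 1
    define U where "U = {p \<in> B \<times> C. heavy (fst p) (snd p)}"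
    have finU: "finite U" using fin by (simp add: U_def)
    have "card Ch * card B \<le> (\<Sum>c\<in>Ch. 2 * card {b\<in>B. heavy b c})"
      using sum_bounded_below[of Ch "card B" "\<lambda>c. 2 * card {b\<in>B. heavy b c}"] by (auto simp: Ch_def)
    also have "\<dots> \<le> (\<Sum>c\<in>C. 2 * card {b\<in>B. heavy b c})"
      using fin by (intro sum_mono2) (auto simp: Ch_def)
    also have "\<dots> = 2 * card U"
      unfolding U_def card_pairs_by_snd[OF fin(2,3)] by (simp add: sum_distrib_left)
    finally have "card Ch * card B \<le> 2 * card U" .
    moreover have "card C * card B \<le> 2 * (card Ch * card B)" using 1 by simp
    ultimately have "card C * card B \<le> 4 * card U" by linarith
    then have U: "card B * card C \<le> 4 * card U" by (simp only: mult.commute)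
    obtain A' where A': "A' \<subseteq> A" "card A' \<le> 2 ^ (2 * j + 13)"
      "card U \<le> 2 * card {u\<in>U. \<exists>a\<in>A'. (a, fst u) \<in> G \<and> (a, snd u) \<in> G}"
      by (rule half_cover[OF fin(1) finU ne(1), of \<delta> "2 ^ (2 * j + 13)"
            "\<lambda>a u. (a, fst u) \<in> G \<and> (a, snd u) \<in> G"])
         (auto simp: \<delta>_def U_def heavy_def)
    define I where "I = {p \<in> B \<times> C. \<exists>a\<in>A'. (a, fst p) \<in> G \<and> (a, snd p) \<in> G}"
    have finI: "finite I" using fin by (simp add: I_def)
    have finA': "finite A'" using A' fin finite_subset by blast
    have "card {u\<in>U. \<exists>a\<in>A'. (a, fst u) \<in> G \<and> (a, snd u) \<in> G} \<le> card I"
      using finI by (intro card_mono) (auto simp: I_def U_def)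
    then have I8: "card B * card C \<le> 8 * card I" using U A'(3) by linarith
    have "card (G \<inter> I) \<le> card A' * card B"
    proof -
      let ?X = "\<lambda>a. {p \<in> B \<times> C. (a, fst p) \<in> G \<and> (a, snd p) \<in> G \<and> p \<in> G}"
      \<comment> \<open>The edge \<open>(a, b)\<close> lies in at most one triangle, so
        \<open>b\<close> determines \<open>c\<close>. The resulting bound is linear in
        \<open>card B\<close>, while \<open>card I\<close> is of order
        \<open>card B * card C\<close>; the lower bound on \<open>card C\<close> makes up for the
        constants.\<close>
      have X: "card (?X a) \<le> card B" for a
      proof (rule card_inj_on_le[of fst])
        show "inj_on fst (?X a)"
          using tri by (auto simp: inj_on_def)
      qed (use fin in auto)
      have "G \<inter> I \<subseteq> (\<Union>a\<in>A'. ?X a)" by (auto simp: I_def)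
      then have "card (G \<inter> I) \<le> card (\<Union>a\<in>A'. ?X a)"
        using finA' fin by (intro card_mono) auto
      also have "\<dots> \<le> (\<Sum>a\<in>A'. card (?X a))" using finA' by (rule card_UN_le)
      also have "\<dots> \<le> card A' * card B"
        using sum_bounded_above[of A' "\<lambda>a. card (?X a)" "card B"] X by simp
      finally show ?thesis .
    qed
    also have "\<dots> \<le> 2 ^ (2 * j + 13) * card B" using A'(2) by simp
    finally have "real (card (G \<inter> I)) \<le> real (2 ^ (2 * j + 13) * card B)"
      by (rule of_nat_mono)
    then have GI: "real (card (G \<inter> I)) \<le> 2 ^ (2 * j + 13) * real (card B)" by simp
    have "8 * real (card (G \<inter> I)) * (8 * 2 ^ j) \<le> 2 ^ (3 * j + 19) * real (card B)"
    proof -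
      have "(2::real) ^ (3 * j + 19) = 2 ^ (2 * j + 13) * 64 * 2 ^ j"
      proof -
        have "3 * j + 19 = (2 * j + 13) + 6 + j" by simp
        then show ?thesis by (simp only: power_add) simp
      qed
      then show ?thesis using GI by simp
    qed
    also have "\<dots> \<le> real (card C) * card B"
      using of_nat_mono[OF C, where 'a=real] by (intro mult_right_mono) auto
    also have "\<dots> \<le> 8 * real (card I)" using I8 of_nat_mono[OF I8, where 'a=real] by (simp add: mult.commute)
    finally have "8 * real (card (G \<inter> I)) \<le> 1 / 2 ^ j * real (card I)"
      by (simp add: field_simps)
    also have "\<dots> \<le> edge_density G B C * real (card I)"
      using dBC by (intro mult_right_mono) auto
    finally have sparse: "8 * real (card (G \<inter> I)) \<le> edge_density G B C * real (card I)" .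
    have "shattered (2 ^ (2 * j + 13)) G B C"
      unfolding shattered_def
    proof (intro exI[of _ "(\<lambda>a. {v. (a, v) \<in> G}) ` A'"] exI[of _ I] conjI)
      show "card ((\<lambda>a. {v. (a, v) \<in> G}) ` A') \<le> 2 ^ (2 * j + 13)"
        using card_image_le[OF finA'] A'(2) le_trans by blast
      show "card B * card C \<le> 16 * card I" using I8 by linarith
    qed (use finA' sparse in \<open>auto simp: I_def\<close>)
    then show ?thesis by blast
  next
    case 2
    define N where "N = (\<lambda>a. {c\<in>Cl. (a, c) \<in> G})"
    \<comment> \<open>Half of \<open>C\<close> may lie outside \<open>Cl\<close>, so the threshold
      16 becomes the factor 8 relative to \<open>Al \<times> Cl\<close>.\<close>
    define Al where "Al = {a\<in>A. 16 * real (card (N a)) < edge_density G A C * card C}"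
    have finAl: "finite Al" and finN: "finite (N a)" for a
      using fin finCh by (auto simp: Al_def N_def)
    consider (a) "card A \<le> 2 * card Al" | (b) "card A \<le> 2 * card (A - Al)"
      using card_Diff_subset[of Al A] fin finAl card_mono[of A Al] by (fastforce simp: Al_def)
    then show ?thesis
    proof cases
      case a
      define I where "I = Al \<times> Cl"
      have big: "card A * card C \<le> 4 * card I"
        using mult_le_mono[OF a 2] by (simp add: I_def card_cartesian_product)
      have "G \<inter> I = (SIGMA a:Al. N a)" by (auto simp: I_def N_def)
      then have "card (G \<inter> I) = (\<Sum>a\<in>Al. card (N a))"
        using finAl finN by (simp add: card_SigmaI)
      then have "16 * real (card (G \<inter> I)) = (\<Sum>a\<in>Al. 16 * real (card (N a)))"
        by (simp add: sum_distrib_left)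
      also have "\<dots> \<le> (\<Sum>a\<in>Al. edge_density G A C * card C)"
        by (intro sum_mono) (auto simp: Al_def)
      also have "\<dots> = edge_density G A C * (card Al * real (card C))" by simp
      also have "\<dots> \<le> edge_density G A C * (2 * card I)"
      proof (rule mult_left_mono)
        have "card Al * card C \<le> 2 * card I" using 2 by (simp add: I_def card_cartesian_product)
        then show "card Al * real (card C) \<le> real (2 * card I)"
          using of_nat_mono[where 'a=real] by fastforce
      qed (use dAC dpos in linarith)
      finally have sparse: "8 * real (card (G \<inter> I)) \<le> edge_density G A C * card I" by (simp add: mult.commute)
      have "shattered (2 ^ (2 * j + 13)) G A C"
        unfolding shattered_def
      proof (intro exI[of _ "{Al, Cl}"] exI[of _ I] conjI)
        have "card {Al, Cl} \<le> 2" by (simp add: card_insert_if)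
        also have "(2::nat) \<le> 2 ^ (2 * j + 13)" by (simp add: self_le_power)
        finally show "card {Al, Cl} \<le> 2 ^ (2 * j + 13)" .
        show "card A * card C \<le> 16 * card I" using big by linarith
      qed (use sparse in \<open>auto simp: I_def Al_def Cl_def\<close>)
      then show ?thesis by blast
    next
      case b
      \<comment> \<open>A vertex outside \<open>Al\<close> has at least
        \<open>4 * \<delta>' * card C\<close> neighbours in \<open>Cl\<close>. At least half of the
        pairs of some \<open>b\<close> with such a neighbour are light, and the \<open>b\<close>
        below the threshold account for at most a quarter, so at least a quarter of all
        \<open>b\<close> reach it.\<close>
      define \<delta>' :: real where "\<delta>' = 1 / 2 ^ (j + 6)"
      define cov where "cov = (\<lambda>c p. c \<in> Cl \<and> (fst p, c) \<in> G \<and> \<not> heavy (snd p) c)"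
      define U where "U = {p \<in> A \<times> B. \<delta>' * card C \<le> card {c\<in>C. cov c p}}"
      have finU: "finite U" using fin by (simp add: U_def)
      have rows: "card B \<le> 4 * card {b\<in>B. \<delta>' * card C \<le> card {c\<in>C. cov c (x, b)}}"
        if x: "x \<in> A - Al" for x
      proof -
        define B1 where "B1 = {b\<in>B. \<delta>' * card C \<le> card {c\<in>C. cov c (x, b)}}"
        have "1 / 2 ^ j * real (card C) \<le> edge_density G A C * card C"
          using dAC by (intro mult_right_mono) auto
        also have "\<dots> \<le> 16 * real (card (N x))" using x by (auto simp: Al_def)
        finally have Nx: "4 * (\<delta>' * card C) \<le> card (N x)"
          by (simp add: \<delta>'_def power_add field_simps)
        have Npos: "card (N x) > 0"
        proof -
          have "0 < \<delta>' * card C" using cpos by (simp add: \<delta>'_def)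
          then show ?thesis using Nx by (intro gr0I) auto
        qed
        have cv: "{c\<in>C. cov c (x, b)} = {c\<in>N x. \<not> heavy b c}" for b
          by (auto simp: cov_def N_def Cl_def)
        have "card (N x) * card B \<le> (\<Sum>c\<in>N x. 2 * card {b\<in>B. \<not> heavy b c})"
        proof -
          have "card B \<le> 2 * card {b\<in>B. \<not> heavy b c}" if "c \<in> N x" for c
          proof -
            have "2 * card {b\<in>B. heavy b c} < card B" using that by (auto simp: N_def Cl_def Ch_def)
            moreover have "card B = card {b\<in>B. heavy b c} + card {b\<in>B. \<not> heavy b c}"
              using fin by (subst card_Un_disjoint[symmetric]) (auto intro!: arg_cong[of _ _ card])
            ultimately show ?thesis by linarith
          qed
          then show ?thesis
            using sum_bounded_below[of "N x" "card B" "\<lambda>c. 2 * card {b\<in>B. \<not> heavy b c}"] by auto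
        qed
        also have "\<dots> = 2 * (\<Sum>b\<in>B. card {c\<in>N x. \<not> heavy b c})"
          using card_pairs_by_snd[OF fin(2) finN[of x], of "\<lambda>b c. \<not> heavy b c"]
            card_pairs_by_fst[OF fin(2) finN[of x], of "\<lambda>b c. \<not> heavy b c"]
          by (simp add: sum_distrib_left)
        finally have "real (card (N x)) * real (card B) \<le> 2 * real (\<Sum>b\<in>B. card {c\<in>N x. \<not> heavy b c})"
          using of_nat_mono[where 'a=real] by fastforce
        also have "real (\<Sum>b\<in>B. card {c\<in>N x. \<not> heavy b c})
            \<le> (\<Sum>b\<in>B. (if b \<in> B1 then real (card (N x)) else 0) + \<delta>' * card C)"
          unfolding of_nat_sum
        proof (rule sum_mono)
          fix b assume bB: "b \<in> B"
          have "card {c\<in>N x. \<not> heavy b c} \<le> card (N x)" using finN by (intro card_mono) auto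
          moreover have "0 \<le> \<delta>' * card C" by (simp add: \<delta>'_def)
          moreover have "real (card {c\<in>N x. \<not> heavy b c}) < \<delta>' * card C" if "b \<notin> B1"
            using that bB by (auto simp: B1_def cv)
          ultimately show "real (card {c\<in>N x. \<not> heavy b c})
              \<le> (if b \<in> B1 then real (card (N x)) else 0) + \<delta>' * card C"
            by (auto simp: add_increasing2 less_imp_le)
        qed
        also have "\<dots> = (\<Sum>b\<in>B. if b \<in> B1 then real (card (N x)) else 0) + card B * (\<delta>' * card C)"
          by (simp add: sum.distrib)
        also have "(\<Sum>b\<in>B. if b \<in> B1 then real (card (N x)) else 0) = (\<Sum>b\<in>B \<inter> B1. real (card (N x)))"
          by (simp only: sum.inter_restrict[OF fin(2)])
        also have "B \<inter> B1 = B1" by (auto simp: B1_def)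
        also have "card B * (\<delta>' * card C) \<le> card B * (card (N x) / 4)"
          using Nx by (intro mult_left_mono) auto
        finally have "real (card (N x)) * real (card B) \<le> real (card (N x)) * (4 * real (card B1))"
          by (simp add: algebra_simps)
        then have "real (card B) \<le> 4 * real (card B1)"
          by (rule mult_left_le_imp_le) (use Npos in simp)
        then show ?thesis unfolding B1_def by linarith
      qed
      have "card (A - Al) * card B \<le> (\<Sum>x\<in>A - Al. 4 * card {b\<in>B. \<delta>' * card C \<le> card {c\<in>C. cov c (x, b)}})"
        using sum_bounded_below[of "A - Al" "card B"
            "\<lambda>x. 4 * card {b\<in>B. \<delta>' * card C \<le> card {c\<in>C. cov c (x, b)}}"] rows by auto
      also have "\<dots> \<le> (\<Sum>x\<in>A. 4 * card {b\<in>B. \<delta>' * card C \<le> card {c\<in>C. cov c (x, b)}})"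
        using fin by (intro sum_mono2) auto
      also have "\<dots> = 4 * card U"
        using card_pairs_by_fst[OF fin(1,2), of "\<lambda>x b. \<delta>' * card C \<le> card {c\<in>C. cov c (x, b)}"]
        by (simp add: U_def sum_distrib_left)
      finally have "card (A - Al) * card B \<le> 4 * card U" .
      moreover have "card A * card B \<le> 2 * (card (A - Al) * card B)" using b by simp
      ultimately have U: "card A * card B \<le> 8 * card U" by linarith
      obtain C' where C': "C' \<subseteq> C" "card C' \<le> 2 ^ (j + 6)" "card U \<le> 2 * card {u\<in>U. \<exists>c\<in>C'. cov c u}"
        by (rule half_cover[OF fin(3) finU ne(2), of \<delta>' "2 ^ (j + 6)" cov])
           (auto simp: \<delta>'_def U_def)
      have finC': "finite C'" using C' fin finite_subset by blast
      define I where "I = {p \<in> A \<times> B. \<exists>c\<in>C'. cov c p}"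
      have finI: "finite I" using fin by (simp add: I_def)
      have "card {u\<in>U. \<exists>c\<in>C'. cov c u} \<le> card I"
        using finI by (intro card_mono) (auto simp: I_def U_def)
      then have I16: "card A * card B \<le> 16 * card I" using U C'(3) by linarith
      have "real (card (G \<inter> I)) \<le> card C' * (card B * (\<delta> * card A))"
      proof -
        let ?X = "\<lambda>c. {p \<in> A \<times> B. cov c p \<and> p \<in> G}"
        \<comment> \<open>If \<open>c\<close> covers an edge \<open>(a, b)\<close>, then
          \<open>a\<close> is a common neighbour of \<open>b\<close> and \<open>c\<close>, and these
          have small codegree.\<close>
        have X: "real (card (?X c)) \<le> card B * (\<delta> * card A)" for c
        proof -
          have "card (?X c) = (\<Sum>b\<in>B. card {a\<in>A. cov c (a, b) \<and> (a, b) \<in> G})"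
            using card_pairs_by_snd[OF fin(1,2), of "\<lambda>a b. cov c (a, b) \<and> (a, b) \<in> G"] by simp
          moreover have "real (card {a\<in>A. cov c (a, b) \<and> (a, b) \<in> G}) \<le> \<delta> * card A" for b
          proof (cases "heavy b c")
            case True
            then have "{a\<in>A. cov c (a, b) \<and> (a, b) \<in> G} = {}" by (auto simp: cov_def)
            then show ?thesis by (simp only: card.empty) (simp add: \<delta>_def)
          next
            case False
            have "card {a\<in>A. cov c (a, b) \<and> (a, b) \<in> G} \<le> card {a\<in>A. (a, b) \<in> G \<and> (a, c) \<in> G}"
              using fin by (intro card_mono) (auto simp: cov_def)
            then show ?thesis using False unfolding heavy_def by linarith
          qed
          ultimately show ?thesis
            using sum_bounded_above[of B "\<lambda>b. real (card {a\<in>A. cov c (a, b) \<and> (a, b) \<in> G})" "\<delta> * card A"]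
            by simp
        qed
        have "G \<inter> I \<subseteq> (\<Union>c\<in>C'. ?X c)" by (auto simp: I_def)
        then have "card (G \<inter> I) \<le> card (\<Union>c\<in>C'. ?X c)"
          using finC' fin by (intro card_mono) auto
        also have "\<dots> \<le> (\<Sum>c\<in>C'. card (?X c))" using finC' by (rule card_UN_le)
        finally have "real (card (G \<inter> I)) \<le> (\<Sum>c\<in>C'. real (card (?X c)))"
          unfolding of_nat_sum[symmetric] by (rule of_nat_mono)
        also have "\<dots> \<le> card C' * (card B * (\<delta> * card A))"
          using sum_bounded_above[of C' "\<lambda>c. real (card (?X c))" "card B * (\<delta> * card A)"] X by simp
        finally show ?thesis .
      qed
      also have "\<dots> \<le> 2 ^ (j + 6) * (card B * (\<delta> * card A))"
      proof (rule mult_right_mono)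
        show "real (card C') \<le> 2 ^ (j + 6)" using of_nat_mono[OF C'(2), where 'a=real] by simp
      qed (simp add: \<delta>_def)
      also have "\<dots> = real (card A * card B) / (128 * 2 ^ j)"
      proof -
        have "(2::real) ^ (2 * j + 13) = 2 ^ (j + 6) * (128 * 2 ^ j)"
        proof -
          have "2 * j + 13 = (j + 6) + (7 + j)" by simp
          then show ?thesis by (simp only: power_add) simp
        qed
        then show ?thesis by (simp add: \<delta>_def field_simps)
      qed
      also have "\<dots> \<le> real (16 * card I) / (128 * 2 ^ j)"
        using of_nat_mono[OF I16, where 'a=real] by (intro divide_right_mono) auto
      finally have "8 * real (card (G \<inter> I)) \<le> 1 / 2 ^ j * real (card I)"
        by (simp add: field_simps)
      also have "\<dots> \<le> edge_density G A B * real (card I)"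
        using dAB by (intro mult_right_mono) auto
      finally have sparse: "8 * real (card (G \<inter> I)) \<le> edge_density G A B * real (card I)" .
      have "shattered (2 ^ (2 * j + 13)) G A B"
        unfolding shattered_def
      proof (intro exI[of _ "(\<lambda>c. {a. (a, c) \<in> G}) ` C' \<union> (\<lambda>c. {b. heavy b c}) ` C'"] exI[of _ I] conjI)
        have "card ((\<lambda>c. {a. (a, c) \<in> G}) ` C' \<union> (\<lambda>c. {b. heavy b c}) ` C')
            \<le> card ((\<lambda>c. {a. (a, c) \<in> G}) ` C') + card ((\<lambda>c. {b. heavy b c}) ` C')"
          by (rule card_Un_le)
        also have "\<dots> \<le> card C' + card C'"
          using finC' by (intro add_mono card_image_le)
        also have "\<dots> \<le> 2 ^ (j + 7)" using C'(2) by (simp add: power_add)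
        also have "(2::nat) ^ (j + 7) \<le> 2 ^ (2 * j + 13)" by (rule power_increasing) auto
        finally show "card ((\<lambda>c. {a. (a, c) \<in> G}) ` C' \<union> (\<lambda>c. {b. heavy b c}) ` C') \<le> 2 ^ (2 * j + 13)" .
        show "I \<subseteq> A \<times> B" by (auto simp: I_def)
        show "\<forall>a a' b b'. (a, b) \<in> I \<longrightarrow> a' \<in> A \<longrightarrow> b' \<in> B \<longrightarrow>
          (\<forall>S\<in>(\<lambda>c. {a. (a, c) \<in> G}) ` C' \<union> (\<lambda>c. {b. heavy b c}) ` C'. (a' \<in> S) = (a \<in> S)) \<longrightarrow>
          (\<forall>S\<in>(\<lambda>c. {a. (a, c) \<in> G}) ` C' \<union> (\<lambda>c. {b. heavy b c}) ` C'. (b' \<in> S) = (b \<in> S)) \<longrightarrow> (a', b') \<in> I"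
        proof (intro allI impI)
          fix a a' b b'
          assume ab: "(a, b) \<in> I" and "a' \<in> A" "b' \<in> B"
            and A: "\<forall>S\<in>(\<lambda>c. {a. (a, c) \<in> G}) ` C' \<union> (\<lambda>c. {b. heavy b c}) ` C'. (a' \<in> S) = (a \<in> S)"
            and B: "\<forall>S\<in>(\<lambda>c. {a. (a, c) \<in> G}) ` C' \<union> (\<lambda>c. {b. heavy b c}) ` C'. (b' \<in> S) = (b \<in> S)"
          from ab obtain c where c: "c \<in> C'" "cov c (a, b)" by (auto simp: I_def)
          have "(a', c) \<in> G \<longleftrightarrow> (a, c) \<in> G"
            using A[rule_format, of "{a. (a, c) \<in> G}"] c(1) by simp
          moreover have "heavy b' c \<longleftrightarrow> heavy b c"
            using B[rule_format, of "{b. heavy b c}"] c(1) by simp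
          ultimately have "cov c (a', b')" using c(2) by (simp add: cov_def)
          then show "(a', b') \<in> I" using c(1) \<open>a' \<in> A\<close> \<open>b' \<in> B\<close> by (auto simp: I_def)
        qed
        show "card A * card B \<le> 16 * card I" by (rule I16)
        show "8 * real (card (G \<inter> I)) \<le> edge_density G A B * real (card I)" by (rule sparse)
      qed (use finC' in simp)
      then show ?thesis by blast
    qed
  qed
qed

section \<open>Energy increment for triangle systems\<close>

text \<open>A finite family \<open>\<A>\<close> of sets encodes the partition of \<open>V\<close> into its atoms; enlarging the
  family refines the partition.\<close>

definition cell :: "'a set \<Rightarrow> 'a set set \<Rightarrow> 'a \<Rightarrow> 'a set" where
  "cell V \<A> v = {u\<in>V. \<forall>S\<in>\<A>. u \<in> S \<longleftrightarrow> v \<in> S}"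

definition pair_cell :: "'a set \<Rightarrow> 'a set set \<Rightarrow> 'a \<times> 'a \<Rightarrow> ('a \<times> 'a) set" where
  "pair_cell V \<A> e = cell V \<A> (fst e) \<times> cell V \<A> (snd e)"

lemma cell_self: "v \<in> V \<Longrightarrow> v \<in> cell V \<A> v"
  by (simp add: cell_def)

lemma cell_subset: "cell V \<A> v \<subseteq> V"
  by (auto simp: cell_def)

lemma cell_eq: "u \<in> cell V \<A> v \<Longrightarrow> cell V \<A> u = cell V \<A> v"
  by (auto simp: cell_def)

lemma cell_antimono: "\<A> \<subseteq> \<B> \<Longrightarrow> cell V \<B> v \<subseteq> cell V \<A> v"
  by (auto simp: cell_def)

lemma cell_map_pair_cell: "cell_map (V \<times> V) (pair_cell V \<A>)"
  unfolding cell_map_def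
proof (intro ballI conjI)
  fix e assume "e \<in> V \<times> V"
  then show "e \<in> pair_cell V \<A> e"
    by (auto simp: pair_cell_def mem_Times_iff cell_self)
  show "pair_cell V \<A> e \<subseteq> V \<times> V"
    unfolding pair_cell_def by (intro Sigma_mono cell_subset)
  fix g assume "g \<in> pair_cell V \<A> e"
  then show "pair_cell V \<A> g = pair_cell V \<A> e"
    unfolding pair_cell_def mem_Times_iff by (metis cell_eq)
qed

lemma cell_density_pair_cell:
  "cell_density G (pair_cell V \<A>) e = edge_density G (cell V \<A> (fst e)) (cell V \<A> (snd e))"
  by (simp add: cell_density_def pair_cell_def edge_density_def card_cartesian_product)

lemma card_cells:
  assumes "finite \<A>"
  shows "finite (cell V \<A> ` V)" "card (cell V \<A> ` V) \<le> 2 ^ card \<A>"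
proof -
  let ?f = "\<lambda>X. {u\<in>V. \<forall>S\<in>\<A>. u \<in> S \<longleftrightarrow> S \<in> X}"
  have "cell V \<A> v = ?f {S\<in>\<A>. v \<in> S}" for v
    by (auto simp: cell_def)
  then have sub: "cell V \<A> ` V \<subseteq> ?f ` Pow \<A>" by blast
  have fin: "finite (?f ` Pow \<A>)" using assms by simp
  show "finite (cell V \<A> ` V)" using sub fin by (rule finite_subset)
  have "card (cell V \<A> ` V) \<le> card (?f ` Pow \<A>)" using fin sub by (rule card_mono)
  also have "\<dots> \<le> card (Pow \<A>)" using assms by (intro card_image_le) simp
  finally show "card (cell V \<A> ` V) \<le> 2 ^ card \<A>" using assms by (simp add: card_Pow)
qed

lemma card_preimage_le:
  assumes "inj_on f T" "finite X" "\<And>t. t \<in> T \<Longrightarrow> P t \<Longrightarrow> f t \<in> X"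
  shows "card {t\<in>T. P t} \<le> card X"
  using assms by (intro card_inj_on_le[of f]) (auto intro: inj_on_subset)

lemma card_Un3_le: "card (A \<union> B \<union> C) \<le> card A + card B + card C"
  using card_Un_le[of "A \<union> B" C] card_Un_le[of A B] by linarith

definition edge12 :: "'a \<times> 'a \<times> 'a \<Rightarrow> 'a \<times> 'a" where "edge12 t = (fst t, fst (snd t))"
definition edge13 :: "'a \<times> 'a \<times> 'a \<Rightarrow> 'a \<times> 'a" where "edge13 t = (fst t, snd (snd t))"
definition edge23 :: "'a \<times> 'a \<times> 'a \<Rightarrow> 'a \<times> 'a" where "edge23 t = (fst (snd t), snd (snd t))"

definition triangle_edges :: "('a \<times> 'a \<times> 'a) set \<Rightarrow> ('a \<times> 'a) set" where
  "triangle_edges T = edge12 ` T \<union> edge13 ` T \<union> edge23 ` T"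

text \<open>\<open>inj\<close> ensures that deleting few vertices or edges destroys few triples;
  \<open>tri\<close> is what \<open>shattered_triple\<close> consumes. With a single vertex set, one
  partition serves all three kinds of pairs.\<close>

locale triangle_system =
  fixes V :: "'a set" and T :: "('a \<times> 'a \<times> 'a) set"
  assumes finV: "finite V" and TV: "T \<subseteq> V \<times> V \<times> V"
    and inj: "inj_on edge12 T" "inj_on edge13 T" "inj_on edge23 T"
    and tri: "\<And>a b c c'. \<lbrakk>(a, b) \<in> triangle_edges T; (a, c) \<in> triangle_edges T;
      (b, c) \<in> triangle_edges T; (a, c') \<in> triangle_edges T; (b, c') \<in> triangle_edges T\<rbrakk> \<Longrightarrow> c = c'"
begin

abbreviation "G \<equiv> triangle_edges T"

lemma finT: "finite T"
  using finV TV by (meson finite_SigmaI finite_subset)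

lemma GV: "G \<subseteq> V \<times> V"
  using TV by (auto simp: triangle_edges_def edge12_def edge13_def edge23_def)

lemma finG: "finite G"
  using GV finV by (meson finite_SigmaI finite_subset)

lemma card_G_le: "card G \<le> 3 * card T"
  unfolding triangle_edges_def
  using card_Un3_le[of "edge12 ` T" "edge13 ` T" "edge23 ` T"] card_image_le[OF finT, of edge12]
    card_image_le[OF finT, of edge13] card_image_le[OF finT, of edge23] by linarith

lemma T_in_G: "t \<in> T \<Longrightarrow> edge12 t \<in> G \<and> edge13 t \<in> G \<and> edge23 t \<in> G"
  by (auto simp: triangle_edges_def)

text \<open>Triples with a vertex in a small cell or an edge in a sparse pair of cells make up at
  most half of \<open>T\<close>. Each other triple has an edge in a shattered pair, and an edge
  serves at most three triples, so shattered pairs hold at least \<open>card T / 6\<close> edges. A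
  pair with \<open>N\<close> edges gains at least \<open>(1/2 - 1/8) * N / 16\<close>, in total
  \<open>card T / 256\<close>, which leaves room for 288. There are at most \<open>4 ^ s\<close>
  pairs of cells, each adding at most \<open>2 ^ (2 * k + 21)\<close> sets.\<close>

lemma energy_increment:
  assumes \<A>: "finite \<A>" "card \<A> \<le> s"
    and dense: "(card V)\<^sup>2 \<le> 2 ^ k * card T" and big: "2 ^ (s + 4 * k + 35) \<le> card V"
  obtains \<A>' where "finite \<A>'" "card \<A>' \<le> s + 2 ^ (2 * k + 21) * 4 ^ s"
    "log_energy G (pair_cell V \<A>) + card T / 288 \<le> log_energy G (pair_cell V \<A>')"
proof -
  define P where "P = cell V \<A>"
  define d where "d = (\<lambda>e. edge_density G (P (fst e)) (P (snd e)))"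
  \<comment> \<open>\<open>K\<close>, \<open>L\<close> and \<open>\<eta>\<close> are the parameters
    of \<open>shattered_triple\<close> for \<open>j = k + 4\<close>. The extra 4 bounds the number
    of sparse edges by \<open>card T / 16\<close>, so that they spoil at most \<open>3/16\<close> of
    the triples.\<close>
  define K :: nat where "K = 2 ^ (2 * k + 21)"
  define L :: nat where "L = 2 ^ (3 * k + 31)"
  define \<eta> :: real where "\<eta> = 1 / 2 ^ (k + 4)"
  have dcell: "cell_density G (pair_cell V \<A>) = d"
    by (rule ext) (simp add: cell_density_pair_cell d_def P_def)
  have finVV: "finite (V \<times> V)" using finV by simp
  have finP: "finite (P v)" for v using cell_subset[of V \<A> v] finV finite_subset unfolding P_def by blast
  have PV: "finite (P ` V)" "card (P ` V) \<le> 2 ^ s"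
    using card_cells[OF \<A>(1), of V] order_trans[OF _ power_increasing[OF \<A>(2), of "2::nat"]]
    unfolding P_def by auto
  note cm = cell_map_pair_cell[of V \<A>]

  define small where "small = {v\<in>V. card (P v) < L}"
  have small: "card small \<le> 2 ^ s * L"
  proof -
    have le: "card A \<le> L" if "A \<in> P ` small" for A using that by (auto simp: small_def)
    have "small \<subseteq> (\<Union>A\<in>P ` small. A)"
      using cell_self[of _ V \<A>] by (auto simp: P_def small_def)
    then have "card small \<le> card (\<Union>A\<in>P ` small. A)"
      using finV finP by (intro card_mono) (auto simp: small_def)
    also have "\<dots> \<le> (\<Sum>A\<in>P ` small. card A)"
      using finV by (intro card_UN_le) (auto simp: small_def)
    also have "\<dots> \<le> card (P ` small) * L"
      using sum_bounded_above[OF le] by simp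
    also have "card (P ` small) \<le> card (P ` V)"
      using PV by (intro card_mono) (auto simp: small_def)
    finally show ?thesis using PV(2) by (meson le_trans mult_le_mono1)
  qed
  have finsmall: "finite small" "finite (V \<times> small)" "finite (small \<times> V)"
    using finV by (auto simp: small_def)
  have comps: "fst t \<in> V" "fst (snd t) \<in> V" "snd (snd t) \<in> V" if "t \<in> T" for t
    using TV that by auto
  define bad1 where "bad1 = {t\<in>T. fst t \<in> small} \<union> {t\<in>T. fst (snd t) \<in> small} \<union> {t\<in>T. snd (snd t) \<in> small}"
  have bad1: "card bad1 \<le> 3 * (card small * card V)"
  proof -
    have "card {t\<in>T. fst t \<in> small} \<le> card (small \<times> V)"
      using comps finsmall by (intro card_preimage_le[OF inj(1)]) (auto simp: edge12_def)
    moreover have "card {t\<in>T. fst (snd t) \<in> small} \<le> card (V \<times> small)"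
      using comps finsmall by (intro card_preimage_le[OF inj(1)]) (auto simp: edge12_def)
    moreover have "card {t\<in>T. snd (snd t) \<in> small} \<le> card (V \<times> small)"
      using comps finsmall by (intro card_preimage_le[OF inj(2)]) (auto simp: edge13_def)
    ultimately show ?thesis
      using card_Un3_le[of "{t\<in>T. fst t \<in> small}" "{t\<in>T. fst (snd t) \<in> small}" "{t\<in>T. snd (snd t) \<in> small}"]
      by (simp add: bad1_def card_cartesian_product mult.commute)
  qed

  define sparse where "sparse = {e\<in>G. d e < \<eta>}"
  have finsparse: "finite sparse" using finG by (simp add: sparse_def)
  have sparse: "real (card sparse) \<le> \<eta> * (card V)\<^sup>2"
  proof -
    let ?W = "\<lambda>e. if d e < \<eta> then 1 else (0::real)"
    have "d g = d e" if "e \<in> V \<times> V" "g \<in> pair_cell V \<A> e" for e g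
    proof -
      have "pair_cell V \<A> g = pair_cell V \<A> e" using cm that unfolding cell_map_def by blast
      then show ?thesis unfolding dcell[symmetric] cell_density_def by simp
    qed
    then have "(\<Sum>e\<in>V \<times> V. ?W e * cell_density G (pair_cell V \<A>) e) = (\<Sum>e\<in>G. ?W e)"
      by (intro sum_cell_density[OF cm finVV GV]) simp
    moreover have "(\<Sum>e\<in>G. ?W e) = card sparse"
      using finG by (simp add: sparse_def sum.If_cases Int_def)
    moreover have "(\<Sum>e\<in>V \<times> V. ?W e * cell_density G (pair_cell V \<A>) e) \<le> (\<Sum>e\<in>V \<times> V. \<eta>)"
      by (rule sum_mono) (auto simp: dcell \<eta>_def)
    ultimately show ?thesis by (simp add: card_cartesian_product power2_eq_square mult.commute)
  qed
  define bad2 where "bad2 = {t\<in>T. edge12 t \<in> sparse} \<union> {t\<in>T. edge13 t \<in> sparse} \<union> {t\<in>T. edge23 t \<in> sparse}"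
  have bad2: "card bad2 \<le> 3 * card sparse"
    using card_Un3_le[of "{t\<in>T. edge12 t \<in> sparse}" "{t\<in>T. edge13 t \<in> sparse}" "{t\<in>T. edge23 t \<in> sparse}"]
      card_preimage_le[OF inj(1) finsparse, of "\<lambda>t. edge12 t \<in> sparse"]
      card_preimage_le[OF inj(2) finsparse, of "\<lambda>t. edge13 t \<in> sparse"]
      card_preimage_le[OF inj(3) finsparse, of "\<lambda>t. edge23 t \<in> sparse"]
    by (simp add: bad2_def)

  define good where "good = T - bad1 - bad2"
  have good: "card T \<le> 2 * card good"
  proof -
    have dense': "real (card V) ^ 2 \<le> 2 ^ k * real (card T)"
      using of_nat_mono[OF dense, where 'a=real] by simp
    have "4 * real (card bad2) \<le> 12 * (\<eta> * real (card V) ^ 2)"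
      using bad2 sparse by simp
    also have "\<dots> \<le> 12 * (\<eta> * (2 ^ k * real (card T)))"
      using dense' by (intro mult_left_mono) (auto simp: \<eta>_def)
    also have "\<dots> \<le> card T" by (simp add: \<eta>_def power_add)
    finally have b2: "4 * card bad2 \<le> card T" by linarith
    have "card bad1 \<le> 3 * (2 ^ s * L * card V)"
      using bad1 small by (meson le_trans mult_le_mono1 mult_le_mono2)
    \<comment> \<open>The size required of \<open>V\<close> absorbs the density
      \<open>2 ^ k\<close>, the \<open>2 ^ s\<close> cells, their size bound \<open>L\<close> and
      the constant 12, rounded up to 16.\<close>
    then have "4 * 2 ^ k * card bad1 \<le> 4 * 2 ^ k * (3 * (2 ^ s * L * card V))"
      by (rule mult_le_mono2)
    also have "\<dots> \<le> 2 ^ (s + 4 * k + 35) * card V"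
    proof -
      have "s + 4 * k + 35 = 4 + k + s + (3 * k + 31)" by simp
      then have "(2::nat) ^ (s + 4 * k + 35) = 16 * 2 ^ k * 2 ^ s * L"
        unfolding L_def by (simp only: power_add) simp
      then show ?thesis by simp
    qed
    also have "\<dots> \<le> card V * card V" using big by (rule mult_le_mono1)
    also have "\<dots> \<le> 2 ^ k * card T" using dense by (simp add: power2_eq_square)
    finally have "2 ^ k * (4 * card bad1) \<le> 2 ^ k * card T" by (simp add: mult.commute mult.left_commute)
    then have b1: "4 * card bad1 \<le> card T" by simp
    have "T \<subseteq> bad1 \<union> bad2 \<union> good" by (auto simp: good_def)
    then have "card T \<le> card (bad1 \<union> bad2 \<union> good)"
      using finT by (intro card_mono) (auto simp: bad1_def bad2_def good_def)
    then show ?thesis using card_Un3_le[of bad1 bad2 good] b1 b2 by linarith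
  qed

  define sh where "sh = (\<lambda>e. shattered K G (P (fst e)) (P (snd e)))"
  define H where "H = {e\<in>G. sh e}"
  have finH: "finite H" using finG by (simp add: H_def)
  have sh3: "edge12 t \<in> H \<or> edge13 t \<in> H \<or> edge23 t \<in> H" if t: "t \<in> good" for t
  proof -
    have tT: "t \<in> T" using t by (simp add: good_def)
    have dense_pairs: "\<eta> \<le> d (edge12 t)" "\<eta> \<le> d (edge13 t)" "\<eta> \<le> d (edge23 t)"
      using t T_in_G[OF tT] by (auto simp: good_def bad2_def sparse_def)
    have L: "L \<le> card (P (snd (snd t)))"
      using t comps[OF tT] by (auto simp: good_def bad1_def small_def)
    have exps: "2 * (k + 4) + 13 = 2 * k + 21" "3 * (k + 4) + 19 = 3 * k + 31" by simp_all
    have "shattered (2 ^ (2 * (k + 4) + 13)) G (P (fst t)) (P (fst (snd t)))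
        \<or> shattered (2 ^ (2 * (k + 4) + 13)) G (P (fst t)) (P (snd (snd t)))
        \<or> shattered (2 ^ (2 * (k + 4) + 13)) G (P (fst (snd t))) (P (snd (snd t)))"
    proof (rule shattered_triple[OF finP finP finP])
      show "c = c'" if "(a, b) \<in> G" "(a, c) \<in> G" "(b, c) \<in> G" "(a, c') \<in> G" "(b, c') \<in> G"
        for a b c c' using that by (rule tri)
      show "2 ^ (3 * (k + 4) + 19) \<le> card (P (snd (snd t)))"
        using L unfolding exps L_def .
    qed (use dense_pairs in \<open>simp_all add: d_def \<eta>_def edge12_def edge13_def edge23_def\<close>)
    then show ?thesis using T_in_G[OF tT]
      unfolding exps K_def[symmetric] H_def sh_def by (auto simp: edge12_def edge13_def edge23_def)
  qed
  have cardH: "card T \<le> 6 * card H"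
  proof -
    have "good \<subseteq> {t\<in>T. edge12 t \<in> H} \<union> {t\<in>T. edge13 t \<in> H} \<union> {t\<in>T. edge23 t \<in> H}"
      using sh3 by (auto simp: good_def)
    then have "card good \<le> card ({t\<in>T. edge12 t \<in> H} \<union> {t\<in>T. edge13 t \<in> H} \<union> {t\<in>T. edge23 t \<in> H})"
      using finT by (intro card_mono) auto
    then show ?thesis
      using good card_Un3_le[of "{t\<in>T. edge12 t \<in> H}" "{t\<in>T. edge13 t \<in> H}" "{t\<in>T. edge23 t \<in> H}"]
        card_preimage_le[OF inj(1) finH, of "\<lambda>t. edge12 t \<in> H"]
        card_preimage_le[OF inj(2) finH, of "\<lambda>t. edge13 t \<in> H"]
        card_preimage_le[OF inj(3) finH, of "\<lambda>t. edge23 t \<in> H"]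
      by simp
  qed

  \<comment> \<open>Indexing by pairs of cells instead of edges means one choice of
    \<open>\<S>\<close> and \<open>I\<close> per pair. This bounds the number of new sets in terms
    of \<open>s\<close> and makes the sets \<open>I p\<close> disjoint.\<close>
  define \<P> where "\<P> = (\<lambda>e. (P (fst e), P (snd e))) ` H"
  have fin\<P>: "finite \<P>" using finH by (simp add: \<P>_def)
  have \<P>sub: "\<P> \<subseteq> P ` V \<times> P ` V" using GV by (auto simp: \<P>_def H_def)
  have card\<P>: "card \<P> \<le> 4 ^ s"
  proof -
    have "card \<P> \<le> card (P ` V) * card (P ` V)"
      using card_mono[OF _ \<P>sub] PV by (simp add: card_cartesian_product)
    also have "\<dots> \<le> 2 ^ s * 2 ^ s" using PV(2) by (intro mult_le_mono)
    finally show ?thesis by (simp add: power_mult_distrib[symmetric])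
  qed
  define shatters where "shatters = (\<lambda>p \<S> I. finite \<S> \<and> card \<S> \<le> K \<and> I \<subseteq> fst p \<times> snd p \<and>
     (\<forall>a a' b b'. (a, b) \<in> I \<longrightarrow> a' \<in> fst p \<longrightarrow> b' \<in> snd p \<longrightarrow>
        (\<forall>S\<in>\<S>. a' \<in> S \<longleftrightarrow> a \<in> S) \<longrightarrow> (\<forall>S\<in>\<S>. b' \<in> S \<longleftrightarrow> b \<in> S) \<longrightarrow> (a', b') \<in> I) \<and>
     card (fst p) * card (snd p) \<le> 16 * card I \<and>
     8 * real (card (G \<inter> I)) \<le> edge_density G (fst p) (snd p) * real (card I))"
  have "\<forall>p\<in>\<P>. \<exists>\<S> I. shatters p \<S> I"
    unfolding \<P>_def H_def sh_def shattered_def shatters_def by simp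
  then obtain \<S> I where SI0: "\<And>p. p \<in> \<P> \<Longrightarrow> shatters p (\<S> p) (I p)"
    by metis
  note SI1 = SI0[unfolded shatters_def]
  have SI: "\<And>p. p \<in> \<P> \<Longrightarrow> finite (\<S> p)"
    "\<And>p. p \<in> \<P> \<Longrightarrow> card (\<S> p) \<le> K" "\<And>p. p \<in> \<P> \<Longrightarrow> I p \<subseteq> fst p \<times> snd p"
    using SI1 by simp_all
  have meas: "(a', b') \<in> I p" if "p \<in> \<P>" "(a, b) \<in> I p" "a' \<in> fst p" "b' \<in> snd p"
        "\<forall>S\<in>\<S> p. a' \<in> S \<longleftrightarrow> a \<in> S" "\<forall>S\<in>\<S> p. b' \<in> S \<longleftrightarrow> b \<in> S" for p a a' b b'
    using SI1[OF that(1)] that(2-) by simp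
  have large: "card (fst p) * card (snd p) \<le> 16 * card (I p)"
    and few: "8 * real (card (G \<inter> I p)) \<le> edge_density G (fst p) (snd p) * real (card (I p))"
    if "p \<in> \<P>" for p
    using SI1[OF that] by simp_all
  define \<A>' where "\<A>' = \<A> \<union> (\<Union>p\<in>\<P>. \<S> p)"
  have sub: "\<A> \<subseteq> \<A>'" by (auto simp: \<A>'_def)
  have fin\<A>': "finite \<A>'" using \<A>(1) fin\<P> SI(1) by (auto simp: \<A>'_def)
  have card\<A>': "card \<A>' \<le> s + K * 4 ^ s"
  proof -
    have "card (\<Union>p\<in>\<P>. \<S> p) \<le> (\<Sum>p\<in>\<P>. card (\<S> p))" using fin\<P> by (rule card_UN_le)
    also have "\<dots> \<le> card \<P> * K" using sum_bounded_above[of \<P> "\<lambda>p. card (\<S> p)" K] SI(2) by simp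
    also have "\<dots> \<le> K * 4 ^ s" using card\<P> by simp
    finally show ?thesis using card_Un_le[of \<A> "\<Union>p\<in>\<P>. \<S> p"] \<A>(2) unfolding \<A>'_def by linarith
  qed

  define J where "J = (\<Union>p\<in>\<P>. I p)"
  have Icell: "fst p = P u" "snd p = P v" "u \<in> V" "v \<in> V" if "p \<in> \<P>" "(u, v) \<in> I p" for p u v
  proof -
    have "p \<in> \<P>" by (rule that(1))
    then obtain x y where p: "p = (P x, P y)" by (auto simp: \<P>_def)
    have "u \<in> P x" "v \<in> P y" using SI(3)[OF that(1)] that(2) p by auto
    then show "fst p = P u" "snd p = P v" "u \<in> V" "v \<in> V"
      using cell_eq[of _ V \<A>] subsetD[OF cell_subset[of V \<A>]] p unfolding P_def by auto
  qed
  have JV: "J \<subseteq> V \<times> V" using Icell by (auto simp: J_def)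
  have finI: "finite (I p)" if "p \<in> \<P>" for p
    using that JV finVV finite_subset[of "I p" "V \<times> V"] by (auto simp: J_def)
  have Jclosed: "g \<in> J" if e: "e \<in> J" and g: "g \<in> pair_cell V \<A>' e" for e g
  proof -
    obtain p where p: "p \<in> \<P>" "e \<in> I p" using e by (auto simp: J_def)
    obtain u v where uv: "e = (u, v)" by (cases e)
    obtain u' v' where g': "g = (u', v')" by (cases g)
    have c: "u' \<in> cell V \<A>' u" "v' \<in> cell V \<A>' v" using g unfolding g' uv pair_cell_def by auto
    have "u' \<in> P u" "v' \<in> P v" using c cell_antimono[OF sub] unfolding P_def by blast+
    then have "u' \<in> fst p" "v' \<in> snd p" using Icell[OF p(1), of u v] p(2) uv by auto
    moreover have "\<S> p \<subseteq> \<A>'" using p(1) by (auto simp: \<A>'_def)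
    then have "\<forall>S\<in>\<S> p. u' \<in> S \<longleftrightarrow> u \<in> S" "\<forall>S\<in>\<S> p. v' \<in> S \<longleftrightarrow> v \<in> S"
      using c by (auto simp: cell_def)
    ultimately have "(u', v') \<in> I p" using meas[OF p(1), of u v u' v'] p(2) uv by simp
    then show ?thesis using p(1) g' by (auto simp: J_def)
  qed
  have "(\<Sum>e\<in>J. cell_density G (pair_cell V \<A>) e) / 2 - ln 2 * real (card (G \<inter> J))
      \<le> log_energy G (pair_cell V \<A>') - log_energy G (pair_cell V \<A>)"
  proof (rule log_energy_gain[OF cm cell_map_pair_cell finVV GV _ JV Jclosed])
    show "pair_cell V \<A>' e \<subseteq> pair_cell V \<A> e" for e
      using cell_antimono[OF sub] unfolding pair_cell_def by (intro Sigma_mono) auto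
  qed
  moreover have "(\<Sum>e\<in>J. cell_density G (pair_cell V \<A>) e)
      = (\<Sum>p\<in>\<P>. edge_density G (fst p) (snd p) * card (I p))"
  proof -
    have "(\<Sum>e\<in>J. cell_density G (pair_cell V \<A>) e) = (\<Sum>p\<in>\<P>. \<Sum>e\<in>I p. d e)"
      unfolding J_def dcell
    proof (rule sum.UNION_disjoint[OF fin\<P>])
      show "\<forall>p\<in>\<P>. finite (I p)" using finI by blast
      show "\<forall>p\<in>\<P>. \<forall>q\<in>\<P>. p \<noteq> q \<longrightarrow> I p \<inter> I q = {}"
      proof (intro ballI impI, rule ccontr)
        fix p q assume pq: "p \<in> \<P>" "q \<in> \<P>" "p \<noteq> q" "I p \<inter> I q \<noteq> {}"
        then obtain u v where "(u, v) \<in> I p" "(u, v) \<in> I q" by auto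
        then have "fst p = fst q" "snd p = snd q"
          using Icell(1,2)[OF pq(1)] Icell(1,2)[OF pq(2)] by metis+
        then show False using pq(3) by (simp add: prod_eq_iff)
      qed
    qed
    also have "\<dots> = (\<Sum>p\<in>\<P>. \<Sum>e\<in>I p. edge_density G (fst p) (snd p))"
    proof (intro sum.cong refl)
      fix p e assume "p \<in> \<P>" "e \<in> I p"
      then show "d e = edge_density G (fst p) (snd p)"
        using Icell(1,2)[of p "fst e" "snd e"] by (simp add: d_def)
    qed
    finally show ?thesis by (simp add: mult.commute)
  qed
  moreover have "ln 2 * real (card (G \<inter> J)) \<le> (\<Sum>p\<in>\<P>. edge_density G (fst p) (snd p) * card (I p)) / 8"
  proof -
    have "G \<inter> J = (\<Union>p\<in>\<P>. G \<inter> I p)" by (auto simp: J_def)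
    then have "card (G \<inter> J) \<le> (\<Sum>p\<in>\<P>. card (G \<inter> I p))" by (simp only: card_UN_le[OF fin\<P>])
    then have "real (card (G \<inter> J)) \<le> (\<Sum>p\<in>\<P>. real (card (G \<inter> I p)))"
      unfolding of_nat_sum[symmetric] by (rule of_nat_mono)
    also have "\<dots> \<le> (\<Sum>p\<in>\<P>. edge_density G (fst p) (snd p) * card (I p) / 8)"
      using few by (intro sum_mono) (simp add: field_simps)
    also have "\<dots> = (\<Sum>p\<in>\<P>. edge_density G (fst p) (snd p) * card (I p)) / 8"
      by (simp add: sum_divide_distrib)
    finally have "real (card (G \<inter> J)) \<le> (\<Sum>p\<in>\<P>. edge_density G (fst p) (snd p) * card (I p)) / 8" .
    moreover have "ln 2 * real (card (G \<inter> J)) \<le> 1 * real (card (G \<inter> J))"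
      using ln_2_less_1 by (intro mult_right_mono) auto
    ultimately show ?thesis by linarith
  qed
  moreover have "real (card H) \<le> 16 * (\<Sum>p\<in>\<P>. edge_density G (fst p) (snd p) * card (I p))"
  proof -
    have "H \<subseteq> (\<Union>p\<in>\<P>. G \<inter> fst p \<times> snd p)"
    proof
      fix e assume e: "e \<in> H"
      then have "e \<in> G" "fst e \<in> V" "snd e \<in> V" using GV by (auto simp: H_def)
      then have "e \<in> G \<inter> P (fst e) \<times> P (snd e)"
        using cell_self[of _ V \<A>] unfolding P_def by (auto simp: mem_Times_iff)
      then show "e \<in> (\<Union>p\<in>\<P>. G \<inter> fst p \<times> snd p)" using e unfolding \<P>_def by force
    qed
    then have "card H \<le> card (\<Union>p\<in>\<P>. G \<inter> fst p \<times> snd p)"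
      using fin\<P> finG by (intro card_mono) auto
    also have "\<dots> \<le> (\<Sum>p\<in>\<P>. card (G \<inter> fst p \<times> snd p))" using fin\<P> by (rule card_UN_le)
    finally have "real (card H) \<le> (\<Sum>p\<in>\<P>. real (card (G \<inter> fst p \<times> snd p)))"
      unfolding of_nat_sum[symmetric] by (rule of_nat_mono)
    also have "\<dots> \<le> (\<Sum>p\<in>\<P>. 16 * (edge_density G (fst p) (snd p) * card (I p)))"
    proof (rule sum_mono)
      fix p assume p: "p \<in> \<P>"
      have ne: "real (card (fst p)) > 0" "real (card (snd p)) > 0"
      proof -
        obtain e where e: "e \<in> G" "p = (P (fst e), P (snd e))"
          using p by (auto simp: \<P>_def H_def)
        have "fst e \<in> V" "snd e \<in> V" using e(1) GV by auto
        then have "fst p \<noteq> {}" "snd p \<noteq> {}" "finite (fst p)" "finite (snd p)"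
          using e(2) finP cell_self[of _ V \<A>] unfolding P_def by auto
        then show "real (card (fst p)) > 0" "real (card (snd p)) > 0"
          by (simp_all add: card_gt_0_iff)
      qed
      have "real (card (G \<inter> fst p \<times> snd p))
          = edge_density G (fst p) (snd p) * (real (card (fst p)) * real (card (snd p)))"
        using ne by (simp add: edge_density_def)
      also have "\<dots> \<le> edge_density G (fst p) (snd p) * (16 * real (card (I p)))"
        using of_nat_mono[OF large[OF p], where 'a=real]
        by (intro mult_left_mono) (auto simp: edge_density_def)
      finally show "real (card (G \<inter> fst p \<times> snd p)) \<le> 16 * (edge_density G (fst p) (snd p) * card (I p))"
        by simp
    qed
    finally show ?thesis by (simp add: sum_distrib_left)
  qed
  moreover have "real (card T) \<le> 6 * real (card H)"
    using cardH by linarith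
  ultimately have "log_energy G (pair_cell V \<A>) + card T / 288 \<le> log_energy G (pair_cell V \<A>')"
    by linarith
  then show ?thesis using that[OF fin\<A>'] card\<A>' unfolding K_def by blast
qed

end

section \<open>Iteration and the Ruzsa--Szemeredi bound\<close>

text \<open>An increment costs one exponential with constants depending on \<open>k\<close>; a
  second exponential per level absorbs these constants and only doubles the height measured by
  \<open>log_star\<close>.\<close>

fun tower :: "nat \<Rightarrow> nat \<Rightarrow> nat" where
  "tower b 0 = b"
| "tower b (Suc i) = 2 ^ (2 ^ tower b i)"

lemma tower_mono_Suc: "tower b i \<le> tower b (Suc i)"
proof -
  have "tower b i < 2 ^ tower b i" by (rule less_exp)
  also have "(2::nat) ^ tower b i < 2 ^ (2 ^ tower b i)" by (rule less_exp)
  finally show ?thesis by simp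
qed

lemma tower_mono: "i \<le> j \<Longrightarrow> tower b i \<le> tower b j"
  by (rule lift_Suc_mono_le[of "tower b"]) (rule tower_mono_Suc)

text \<open>As \<open>s\<close> exceeds the exponents that involve \<open>k\<close>, both quantities
  are at most \<open>2 ^ (3 * s + 1)\<close>, hence at most \<open>2 ^ (2 ^ s)\<close>.\<close>

lemma tower_Suc_ge:
  assumes "4 * k + 36 \<le> s" "s \<le> tower b i"
  shows "s + 2 ^ (2 * k + 21) * 4 ^ s \<le> tower b (Suc i)" "2 ^ (s + 4 * k + 35) \<le> tower b (Suc i)"
proof -
  have lin: "3 * m + 1 \<le> 2 ^ m" if "4 \<le> m" for m :: nat
    using that by (induction m rule: dec_induct) auto
  have exp3: "2 ^ (3 * s + 1) \<le> tower b (Suc i)"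
  proof -
    have "(2::nat) ^ (3 * s + 1) \<le> 2 ^ (2 ^ s)"
      using lin[of s] assms by (intro power_increasing) auto
    also have "\<dots> \<le> 2 ^ (2 ^ tower b i)"
      using assms by (intro power_increasing) auto
    finally show ?thesis by simp
  qed
  have "s \<le> 2 ^ (3 * s)"
  proof -
    have "(2::nat) ^ s \<le> 2 ^ (3 * s)" by (intro power_increasing) auto
    then show ?thesis using less_exp[of s] by linarith
  qed
  moreover have "2 ^ (2 * k + 21) * 4 ^ s \<le> (2::nat) ^ (3 * s)"
  proof -
    have "(2::nat) ^ (2 * k + 21) * 4 ^ s \<le> 2 ^ s * 4 ^ s"
      using assms by (intro mult_le_mono1 power_increasing) auto
    also have "\<dots> = (2 * 4) ^ s" by (simp only: power_mult_distrib)
    also have "(2 * 4) ^ s = (2::nat) ^ (3 * s)" by (simp add: power_mult)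
    finally show ?thesis .
  qed
  moreover have "(2::nat) ^ (3 * s + 1) = 2 ^ (3 * s) + 2 ^ (3 * s)" by simp
  ultimately show "s + 2 ^ (2 * k + 21) * 4 ^ s \<le> tower b (Suc i)" using exp3 by linarith
  have "(2::nat) ^ (s + 4 * k + 35) \<le> 2 ^ (3 * s + 1)" using assms by (intro power_increasing) auto
  then show "2 ^ (s + 4 * k + 35) \<le> tower b (Suc i)" using exp3 by linarith
qed

context triangle_system
begin

lemma iterated_energy_increment:
  assumes dense: "(card V)\<^sup>2 \<le> 2 ^ k * card T" and big: "tower (4 * k + 36) r \<le> card V"
  shows "\<exists>\<A>. finite \<A> \<and> card \<A> \<le> tower (4 * k + 36) r \<and>
           log_energy G (pair_cell V {}) + real r * real (card T) / 288 \<le> log_energy G (pair_cell V \<A>)"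
  using big
proof (induction r)
  case 0
  show ?case by (intro exI[of _ "{}"]) auto
next
  case (Suc r)
  let ?s = "tower (4 * k + 36) r"
  have "?s \<le> card V" by (rule le_trans[OF tower_mono_Suc Suc.prems])
  then obtain \<A> where \<A>: "finite \<A>" "card \<A> \<le> ?s"
    "log_energy G (pair_cell V {}) + real r * real (card T) / 288 \<le> log_energy G (pair_cell V \<A>)"
    using Suc.IH by blast
  have s: "4 * k + 36 \<le> ?s" using tower_mono[of 0 r "4 * k + 36"] by simp
  note step = tower_Suc_ge[OF s order_refl]
  obtain \<A>' where \<A>': "finite \<A>'" "card \<A>' \<le> ?s + 2 ^ (2 * k + 21) * 4 ^ ?s"
    "log_energy G (pair_cell V \<A>) + card T / 288 \<le> log_energy G (pair_cell V \<A>')"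
    using energy_increment[OF \<A>(1,2) dense le_trans[OF step(2) Suc.prems]] by blast
  have "real (Suc r) * real (card T) / 288 = real r * real (card T) / 288 + real (card T) / 288"
    by (simp add: field_simps)
  then have "log_energy G (pair_cell V {}) + real (Suc r) * real (card T) / 288 \<le> log_energy G (pair_cell V \<A>')"
    using \<A>(3) \<A>'(3) by linarith
  with \<A>'(1) le_trans[OF \<A>'(2) step(1)] show ?case by (intro exI[of _ \<A>'] conjI)
qed

text \<open>With a single cell every edge has density \<open>card G / (card V)\<^sup>2\<close>, at
  least \<open>1 / 2 ^ k\<close>, so each of the at most \<open>3 * card T\<close> edges contributes
  at least \<open>- k\<close>.\<close>

lemma initial_energy:
  assumes dense: "(card V)\<^sup>2 \<le> 2 ^ k * card T" and ne: "T \<noteq> {}"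
  shows "- (3 * real k * card T) \<le> log_energy G (pair_cell V {})"
proof -
  have Vne: "V \<noteq> {}" using ne TV by blast
  have pos: "real (card V) > 0" "real (card T) > 0" using Vne finV ne finT by (auto simp: card_gt_0_iff)
  have TG: "card T \<le> card G"
  proof -
    have "edge12 ` T \<subseteq> G" by (auto simp: triangle_edges_def)
    then show ?thesis using card_image[OF inj(1)] card_mono[OF finG] by metis
  qed
  have "- real k \<le> ln (cell_density G (pair_cell V {}) e)" for e
  proof -
    have "pair_cell V {} e = V \<times> V" by (simp add: pair_cell_def cell_def)
    moreover have "G \<inter> V \<times> V = G" using GV by blast
    ultimately have d: "cell_density G (pair_cell V {}) e = real (card G) / (real (card V))\<^sup>2"
      by (simp add: cell_density_def card_cartesian_product power2_eq_square)
    have "(real (card V))\<^sup>2 \<le> 2 ^ k * real (card T)"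
      using of_nat_mono[OF dense, where 'a=real] by simp
    also have "\<dots> \<le> 2 ^ k * real (card G)" using TG by simp
    finally have "1 / 2 ^ k \<le> cell_density G (pair_cell V {}) e"
      using pos unfolding d by (simp add: field_simps)
    then have "ln (1 / 2 ^ k) \<le> ln (cell_density G (pair_cell V {}) e)"
      by (intro ln_mono) (auto intro: less_le_trans[of 0 "1 / 2 ^ k"])
    moreover have "ln (1 / 2 ^ k :: real) = - (real k * ln 2)"
      by (simp add: ln_div ln_realpow)
    moreover have "real k * ln 2 \<le> real k * 1" using ln_2_less_1 by (intro mult_left_mono) auto
    ultimately show ?thesis by linarith
  qed
  then have "(\<Sum>e\<in>G. - real k) \<le> log_energy G (pair_cell V {})"
    unfolding log_energy_def by (intro sum_mono)
  moreover have "real k * real (card G) \<le> real k * (3 * real (card T))"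
    using card_G_le by (intro mult_left_mono) auto
  moreover have "(\<Sum>e\<in>G. - real k) = - (real k * real (card G))" by simp
  ultimately show ?thesis by (simp add: algebra_simps)
qed

text \<open>Since \<open>864 = 3 * 288\<close>, the first \<open>864 * k\<close> increments make up
  for the initial deficit \<open>3 * k * card T\<close>; one more would make the energy
  positive.\<close>

lemma few_triangles:
  assumes big: "tower (4 * k + 36) (864 * k + 1) \<le> card V"
  shows "2 ^ k * card T < (card V)\<^sup>2"
proof (rule ccontr)
  assume "\<not> ?thesis"
  then have dense: "(card V)\<^sup>2 \<le> 2 ^ k * card T" by simp
  have "tower (4 * k + 36) 0 \<le> card V" by (rule le_trans[OF tower_mono big]) simp
  then have "card V > 0" by simp
  then have T: "T \<noteq> {}" using dense by (intro notI) simp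
  then have pos: "real (card T) > 0" using finT by (simp add: card_gt_0_iff)
  obtain \<A> where "log_energy G (pair_cell V {}) + real (864 * k + 1) * real (card T) / 288 \<le> log_energy G (pair_cell V \<A>)"
    using iterated_energy_increment[OF dense big] by blast
  moreover have "log_energy G (pair_cell V \<A>) \<le> 0"
    using finV by (intro log_energy_nonpos[OF cell_map_pair_cell _ GV]) auto
  moreover have "real (864 * k + 1) * real (card T) / 288 = 3 * real k * card T + card T / 288"
    by (simp add: field_simps)
  ultimately show False using initial_energy[OF dense T] pos by linarith
qed

end

section \<open>The iterated logarithm of a tower\<close>

lemma log_star_eq_0: "x \<le> 1 \<Longrightarrow> log_star x = 0"
  unfolding log_star_def by (intro Least_eq_0) simp

lemma log_star_step:
  assumes "x > 1"
  shows "log_star x = Suc (log_star (log 2 x))"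
proof -
  obtain k where "(log 2 ^^ k) x \<le> 1" using log_star_exists by blast
  then show ?thesis
    using Least_Suc[of "\<lambda>k. (log 2 ^^ k) x \<le> 1" k] assms
    by (simp add: log_star_def funpow_Suc_right del: funpow.simps)
qed

lemma log_star_mono: "x \<le> y \<Longrightarrow> log_star x \<le> log_star y"
proof (induction "log_star y" arbitrary: x y rule: less_induct)
  case less
  show ?case
  proof (cases "x \<le> 1")
    case True
    then show ?thesis by (simp add: log_star_eq_0)
  next
    case False
    then have xy: "x > 1" "y > 1" "log 2 x \<le> log 2 y" using less.prems by auto
    then show ?thesis
      using less.hyps[of "log 2 y" "log 2 x"] log_star_step[OF xy(1)] log_star_step[OF xy(2)] by simp
  qed
qed

lemma log_star_le: "log_star (real m) \<le> m"
proof (induction m)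
  case 0
  show ?case by (simp add: log_star_eq_0)
next
  case (Suc m)
  show ?case
  proof (cases "m = 0")
    case True
    then show ?thesis by (simp add: log_star_eq_0)
  next
    case False
    have "real (Suc m) \<le> 2 ^ m"
      using Suc_leI[OF less_exp[of m]] by (simp only: of_nat_le_numeral_power_cancel_iff)
    then have "log 2 (real (Suc m)) \<le> real m"
      using log_le_iff[of 2 "real (Suc m)" "real m"] powr_realpow[of 2 m] by auto
    then have "log_star (log 2 (real (Suc m))) \<le> m" by (rule le_trans[OF log_star_mono Suc.IH])
    then show ?thesis using log_star_step[of "real (Suc m)"] False by simp
  qed
qed

lemma log_star_exp: "log_star (2 ^ m) \<le> Suc (log_star (real m))"
proof (cases "m = 0")
  case True
  then show ?thesis by (simp add: log_star_eq_0)
next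
  case False
  then show ?thesis using log_star_step[of "2 ^ m"] by (simp add: log_nat_power)
qed

lemma log_star_tower: "log_star (real (tower b i)) \<le> b + 2 * i"
proof (induction i)
  case 0
  show ?case by (simp add: log_star_le)
next
  case (Suc i)
  have "log_star (real (tower b (Suc i))) \<le> Suc (log_star (real (2 ^ tower b i)))"
    using log_star_exp[of "2 ^ tower b i"] by simp
  also have "\<dots> \<le> Suc (Suc (log_star (real (tower b i))))"
    using log_star_exp[of "tower b i"] by simp
  finally show ?case using Suc.IH by simp
qed

text \<open>Three copies of \<open>X\<close> give \<open>card V = 3 * n\<close>; passing from
  \<open>k\<close> to \<open>k + 4\<close> absorbs the factor 9. The constants are
  \<open>b + 2 * i\<close> from \<open>log_star_tower\<close> with
  \<open>b = 4 * (k + 4) + 36\<close> and \<open>i = 864 * (k + 4) + 1\<close>. In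
  \<open>tri\<close>, the triangle \<open>x\<close>, \<open>y'\<close>, \<open>z\<close> takes one
  edge from each triple, and the conclusion makes it a triple of \<open>F\<close>.\<close>

lemma ruzsa_szemeredi:
  fixes F :: "('a \<times> 'a \<times> 'a) set"
  assumes X: "finite X" "card X = n" and F: "F \<subseteq> X \<times> X \<times> X"
    and lin: "\<And>x y z z'. (x, y, z) \<in> F \<Longrightarrow> (x, y, z') \<in> F \<Longrightarrow> z = z'"
      "\<And>x y y' z. (x, y, z) \<in> F \<Longrightarrow> (x, y', z) \<in> F \<Longrightarrow> y = y'"
      "\<And>x x' y z. (x, y, z) \<in> F \<Longrightarrow> (x', y, z) \<in> F \<Longrightarrow> x = x'"
    and tri: "\<And>x y z x' y' z'. (x, y, z) \<in> F \<Longrightarrow> (x, y', z') \<in> F \<Longrightarrow> (x', y', z) \<in> F \<Longrightarrow> y = y'"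
    and n: "1732 * k + 6966 < log_star (real n)"
  shows "2 ^ k * card F \<le> n\<^sup>2"
proof (rule ccontr)
  assume "\<not> ?thesis"
  then have many: "n\<^sup>2 < 2 ^ k * card F" by simp
  \<comment> \<open>All edges lead from a lower to a higher tag, so the vertices \<open>a\<close>,
    \<open>b\<close>, \<open>c\<close> of a triangle have the tags 0, 1, 2 in this order.\<close>
  let ?tag = "\<lambda>t. ((0::nat, fst t), (1::nat, fst (snd t)), (2::nat, snd (snd t)))"
  define V where "V = {0, 1, 2::nat} \<times> X"
  define T where "T = ?tag ` F"
  define G where "G = triangle_edges T"
  have G: "e \<in> G \<longleftrightarrow> (\<exists>x y z. (x, y, z) \<in> F \<and>
      (e = ((0, x), (1, y)) \<or> e = ((0, x), (2, z)) \<or> e = ((1, y), (2, z))))" for e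
    unfolding G_def T_def triangle_edges_def edge12_def edge13_def edge23_def image_image image_Un[symmetric]
    by (fastforce simp: image_iff)
  have cardV: "card V = 3 * n" using X by (simp add: V_def card_cartesian_product)
  interpret triangle_system V T
  proof
    show "finite V" using X by (simp add: V_def)
    show "T \<subseteq> V \<times> V \<times> V" using F by (auto simp: T_def V_def)
    show "inj_on edge12 T" using lin(1) by (auto simp: inj_on_def T_def edge12_def)
    show "inj_on edge13 T" using lin(2) by (auto simp: inj_on_def T_def edge13_def)
    show "inj_on edge23 T" using lin(3) by (auto simp: inj_on_def T_def edge23_def)
    fix a b c c'
    assume E: "(a, b) \<in> triangle_edges T" "(a, c) \<in> triangle_edges T" "(b, c) \<in> triangle_edges T"
      "(a, c') \<in> triangle_edges T" "(b, c') \<in> triangle_edges T"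
    note E = E[folded G_def]
    obtain x y where ab: "a = (0, x)" "b = (1, y)" using E(1,3) unfolding G by auto
    \<comment> \<open>The edges of a triangle may stem from three triples; \<open>tri\<close>
      identifies \<open>y'\<close> with \<open>y\<close>, so the triangle is itself a triple and
      \<open>lin(1)\<close> yields uniqueness.\<close>
    have c: "\<exists>z. d = (2, z) \<and> (x, y, z) \<in> F" if "(a, d) \<in> G" "(b, d) \<in> G" for d
    proof -
      have "\<exists>z x' y'. d = (2, z) \<and> (x', y, z) \<in> F \<and> (x, y', z) \<in> F"
        using that unfolding G ab by auto
      then obtain z x' y' where d: "d = (2, z)" "(x', y, z) \<in> F" "(x, y', z) \<in> F" by blast
      obtain z'' where "(x, y, z'') \<in> F" using E(1) unfolding G ab by auto
      then show ?thesis using tri[OF d(3) _ d(2)] d by blast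
    qed
    show "c = c'" using c[OF E(2,3)] c[OF E(4,5)] lin(1) by blast
  qed
  have "tower (4 * (k + 4) + 36) (864 * (k + 4) + 1) < n"
  proof (rule ccontr)
    assume "\<not> ?thesis"
    then have "log_star (real n) \<le> log_star (real (tower (4 * (k + 4) + 36) (864 * (k + 4) + 1)))"
      by (intro log_star_mono) simp
    also have "\<dots> \<le> 4 * (k + 4) + 36 + 2 * (864 * (k + 4) + 1)" by (rule log_star_tower)
    finally show False using n by simp
  qed
  then have "2 ^ (k + 4) * card T < (card V)\<^sup>2"
    using cardV by (intro few_triangles) simp
  moreover have "card T = card F"
    unfolding T_def by (intro card_image) (auto simp: inj_on_def)
  ultimately have "16 * (2 ^ k * card F) < 9 * n\<^sup>2"
    using cardV by (simp add: power_add power_mult_distrib mult.commute mult.left_commute)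
  then show False using many by linarith
qed

section \<open>The relation and its non-redundancy\<close>

text \<open>The value 0 means equality with the corresponding variable of the violated constraint; the
  values 1 and 2 of \<open>y\<close> stand for smaller and larger variables.\<close>

definition pattern :: "nat \<Rightarrow> nat \<Rightarrow> nat \<Rightarrow> nat \<Rightarrow> bool" where
  "pattern x y w z \<longleftrightarrow> x \<le> 1 \<and> y \<le> 2 \<and> w \<le> 1 \<and> z \<le> 1 \<and>
     (x = 1 \<and> w = 1 \<or> x = 1 \<and> y = 2 \<or> x = 0 \<and> y = 1 \<and> w = 1 \<or> x = 0 \<and> y = 0 \<and> w = 0 \<and> z = 1)"

definition pattern_rel :: "nat list set" where
  "pattern_rel = {S \<in> nlists 4 {0, 1, 2}. pattern (S ! 0) (S ! 1) (S ! 2) (S ! 3)}"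

text \<open>The Kovari--Sos--Turan argument: two distinct elements of \<open>Y\<close> have at most
  one common neighbour, so the squared degrees sum to at most \<open>2 * n\<^sup>2\<close>, while an
  average degree above \<open>n / 2 ^ k\<close> makes this sum exceed
  \<open>n ^ 3 / 4 ^ k\<close>.\<close>

lemma card_C4_free:
  fixes Q :: "('a \<times> 'b) set"
  assumes X: "finite X" "card X = n" and Y: "finite Y" "card Y = n" and Q: "Q \<subseteq> X \<times> Y"
    and free: "\<And>x x' y y'. \<lbrakk>(x, y) \<in> Q; (x', y) \<in> Q; (x, y') \<in> Q; (x', y') \<in> Q; y \<noteq> y'\<rbrakk> \<Longrightarrow> x = x'"
    and n: "2 * 4 ^ k < n"
  shows "2 ^ k * card Q \<le> n\<^sup>2"
proof (rule ccontr)
  assume "\<not> ?thesis"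
  then have "n\<^sup>2 < 2 ^ k * card Q" by simp
  then have many: "(real n)\<^sup>2 < 2 ^ k * real (card Q)"
    using of_nat_less_iff[of "n\<^sup>2" "2 ^ k * card Q", where 'a=real] by simp
  have npos: "real n > 0" using n by simp
  define N where "N = (\<lambda>x. {y\<in>Y. (x, y) \<in> Q})"
  have finN: "finite (N x)" for x using Y by (simp add: N_def)
  have finQ: "finite Q" using Q X Y by (meson finite_SigmaI finite_subset)
  have "Q = (SIGMA x:X. N x)" using Q by (auto simp: N_def)
  then have cardQ: "card Q = (\<Sum>x\<in>X. card (N x))" using X finN by (simp add: card_SigmaI)
  have sq: "(\<Sum>x\<in>X. (card (N x))\<^sup>2) \<le> 2 * n\<^sup>2"
  proof -
    have "(\<Sum>x\<in>X. (card (N x))\<^sup>2) = card (SIGMA x:X. N x \<times> N x)"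
      using X finN by (simp add: card_SigmaI card_cartesian_product power2_eq_square)
    also have "(SIGMA x:X. N x \<times> N x)
        = (\<lambda>(x, y). (x, y, y)) ` Q \<union> {(x, y, y'). (x, y) \<in> Q \<and> (x, y') \<in> Q \<and> y \<noteq> y'}"
      using Q by (auto simp: N_def)
    also have "card \<dots> \<le> card ((\<lambda>(x, y). (x, y, y)) ` Q) + card {(x, y, y'). (x, y) \<in> Q \<and> (x, y') \<in> Q \<and> y \<noteq> y'}"
      by (rule card_Un_le)
    also have "card ((\<lambda>(x, y). (x, y, y)) ` Q) \<le> card (X \<times> Y)"
      using card_image_le[OF finQ] card_mono[OF _ Q] X Y by (meson finite_SigmaI le_trans)
    also have "card {(x, y, y'). (x, y) \<in> Q \<and> (x, y') \<in> Q \<and> y \<noteq> y'} \<le> card (Y \<times> Y)"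
    proof (rule card_inj_on_le[of snd])
      show "inj_on snd {(x, y, y'). (x, y) \<in> Q \<and> (x, y') \<in> Q \<and> y \<noteq> y'}"
        using free by (auto simp: inj_on_def)
    qed (use Q Y in auto)
    finally show ?thesis using X Y by (simp add: card_cartesian_product power2_eq_square)
  qed
  \<comment> \<open>Cauchy--Schwarz in tangent form,
    \<open>2 * t * d - t\<^sup>2 \<le> d\<^sup>2\<close>, taken at the value that
    \<open>many\<close> makes the average degree exceed.\<close>
  define t where "t = real n / 2 ^ k"
  have tpos: "t > 0" using npos by (simp add: t_def)
  have "real n * t < real (card Q)"
    using many by (simp add: t_def field_simps power2_eq_square)
  then have "2 * t * (real n * t) - real n * t\<^sup>2 \<le> 2 * t * real (card Q) - real n * t\<^sup>2"
    using tpos by (intro diff_mono mult_left_mono) auto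
  also have "\<dots> = (\<Sum>x\<in>X. 2 * t * real (card (N x)) - t\<^sup>2)"
    using X by (simp add: cardQ sum_subtractf sum_distrib_left)
  also have "\<dots> \<le> (\<Sum>x\<in>X. (real (card (N x)))\<^sup>2)"
  proof (rule sum_mono)
    fix x
    have "0 \<le> (real (card (N x)) - t)\<^sup>2" by simp
    then show "2 * t * real (card (N x)) - t\<^sup>2 \<le> (real (card (N x)))\<^sup>2"
      by (simp add: power2_diff mult.commute mult.left_commute)
  qed
  also have "\<dots> \<le> 2 * (real n)\<^sup>2"
    using of_nat_mono[OF sq, where 'a=real] by simp
  finally have "2 * t * (real n * t) - real n * t\<^sup>2 \<le> 2 * (real n)\<^sup>2" .
  moreover have "2 * t * (real n * t) - real n * t\<^sup>2 = real n * t\<^sup>2"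
    by (simp add: power2_eq_square algebra_simps)
  ultimately have "real n * t\<^sup>2 \<le> 2 * (real n)\<^sup>2" by (simp only:)
  moreover have "real n * t\<^sup>2 = (real n)\<^sup>2 * (real n / 4 ^ k)"
    by (simp add: t_def power2_eq_square flip: power_mult_distrib)
  ultimately have "(real n)\<^sup>2 * (real n / 4 ^ k) \<le> (real n)\<^sup>2 * 2" by simp
  then have "real n / 4 ^ k \<le> 2" by (rule mult_left_le_imp_le) (use npos in simp)
  then have "real n \<le> real (2 * 4 ^ k)" by (simp add: field_simps)
  then show False using n by linarith
qed

lemma card_by_slices:
  assumes X: "finite X" "card X = n" and E: "finite E" "\<And>e. e \<in> E \<Longrightarrow> g e \<in> X"
    and slice: "\<And>c. c \<in> X \<Longrightarrow> 2 ^ k * card {e\<in>E. g e = c} \<le> n\<^sup>2"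
  shows "2 ^ k * card E \<le> n ^ 3"
proof -
  have "E = (\<Union>c\<in>X. {e\<in>E. g e = c})" using E(2) by auto
  then have "card E \<le> (\<Sum>c\<in>X. card {e\<in>E. g e = c})"
    using card_UN_le[OF X(1), of "\<lambda>c. {e\<in>E. g e = c}"] by simp
  then have "2 ^ k * card E \<le> (\<Sum>c\<in>X. 2 ^ k * card {e\<in>E. g e = c})"
    by (simp add: sum_distrib_left[symmetric])
  also have "\<dots> \<le> (\<Sum>c\<in>X. n\<^sup>2)" using slice by (rule sum_mono)
  also have "\<dots> = n ^ 3" using X(2) by (simp add: power2_eq_square power3_eq_cube)
  finally show ?thesis .
qed

lemma exp_less_of_log_star:
  assumes "Suc m < log_star (real n)"
  shows "2 ^ m < n"
proof (rule ccontr)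
  assume "\<not> ?thesis"
  then have "real n \<le> 2 ^ m" using of_nat_mono[of n "2 ^ m", where 'a=real] by simp
  then have "log_star (real n) \<le> log_star (2 ^ m)" by (rule log_star_mono)
  then show False using log_star_exp[of m] log_star_le[of m] assms by linarith
qed

text \<open>A set of constraints all of whose witnesses take the same values on the constraint they
  violate.\<close>

locale uniform_instance =
  fixes X :: "'v set" and n :: nat and E :: "('v \<times> 'v \<times> 'v \<times> 'v) set" and a b c d :: nat and k :: nat
  assumes X: "finite X" "card X = n" and EX: "E \<subseteq> X \<times> X \<times> X \<times> X"
    and n: "1732 * k + 6966 < log_star (real n)"
    and witness: "\<And>x y w z. (x, y, w, z) \<in> E \<Longrightarrow> \<exists>\<phi>. \<phi> x = a \<and> \<phi> y = b \<and> \<phi> w = c \<and> \<phi> z = d \<and>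
        (\<forall>x' y' w' z'. (x', y', w', z') \<in> E \<longrightarrow> (x', y', w', z') \<noteq> (x, y, w, z) \<longrightarrow>
           pattern (\<phi> x') (\<phi> y') (\<phi> w') (\<phi> z'))"
begin

lemma finE: "finite E"
  using EX X by (meson finite_SigmaI finite_subset)

lemma n_large: "2 * 4 ^ k < n"
proof -
  have "(2::nat) ^ (2 * k + 1) < n" using n by (intro exp_less_of_log_star) simp
  then show ?thesis by (simp add: power_mult)
qed

lemma card_if_pair_determines:
  assumes "inj_on f E" "\<And>e. e \<in> E \<Longrightarrow> f e \<in> X \<times> X"
  shows "2 ^ k * card E \<le> n ^ 3"
proof -
  have "card E \<le> card (X \<times> X)" using assms X by (intro card_inj_on_le[OF assms(1)] image_subsetI) simp_all
  also have "\<dots> = n\<^sup>2" using X by (simp add: card_cartesian_product power2_eq_square)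
  finally have "2 ^ k * card E \<le> 2 ^ k * n\<^sup>2" by simp
  also have "(2::nat) ^ k \<le> 4 ^ k" by (rule power_mono) auto
  then have "2 ^ k * n\<^sup>2 \<le> n * n\<^sup>2" using n_large by (intro mult_le_mono1) linarith
  also have "n * n\<^sup>2 = n ^ 3" by (simp add: power2_eq_square power3_eq_cube)
  finally show ?thesis .
qed

text \<open>A second constraint with the same \<open>x\<close> and \<open>y\<close> would have to be
  satisfied by a witness with values \<open>a\<close> and \<open>b\<close> there, and no pattern
  starts that way. The next two lemmas use other pairs of coordinates.\<close>

lemma card_if_no_xy:
  assumes "\<And>w z. \<not> pattern a b w z"
  shows "2 ^ k * card E \<le> n ^ 3"
proof (rule card_if_pair_determines[of "\<lambda>(x, y, w, z). (x, y)"])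
  show "inj_on (\<lambda>(x, y, w, z). (x, y)) E"
    using witness assms by (fastforce simp: inj_on_def)
qed (use EX in auto)

lemma card_if_no_xz:
  assumes "\<And>y w. \<not> pattern a y w d"
  shows "2 ^ k * card E \<le> n ^ 3"
proof (rule card_if_pair_determines[of "\<lambda>(x, y, w, z). (x, z)"])
  show "inj_on (\<lambda>(x, y, w, z). (x, z)) E"
    using witness assms by (fastforce simp: inj_on_def)
qed (use EX in auto)

lemma card_if_no_yw:
  assumes "\<And>x z. \<not> pattern x b c z"
  shows "2 ^ k * card E \<le> n ^ 3"
proof (rule card_if_pair_determines[of "\<lambda>(x, y, w, z). (y, w)"])
  show "inj_on (\<lambda>(x, y, w, z). (y, w)) E"
    using witness assms by (fastforce simp: inj_on_def)
qed (use EX in auto)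

text \<open>For fixed \<open>w\<close> take a 4-cycle with the violated constraint at
  \<open>(x, y)\<close>. The corner \<open>(x', y)\<close> forces 0 on \<open>x'\<close>, the corner
  \<open>(x, y')\<close> forces 2 on \<open>y'\<close>, and no pattern starts with 0, 2. Moreover
  \<open>z\<close> is determined by the rest, as no pattern starts with 1, 0, 0.\<close>

lemma card_if_C4_in_xy:
  assumes v: "a = 1" "b = 0" "c = 0"
  shows "2 ^ k * card E \<le> n ^ 3"
proof (rule card_by_slices[OF X finE, of "\<lambda>(x, y, w, z). w"])
  fix w0 assume "w0 \<in> X"
  define S where "S = {e\<in>E. (\<lambda>(x, y, w, z). w) e = w0}"
  define Q where "Q = (\<lambda>(x, y, w, z). (x, y)) ` S"
  have SE: "(x, y, w, z) \<in> S \<longleftrightarrow> (x, y, w, z) \<in> E \<and> w = w0" for x y w z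
    by (auto simp: S_def)
  have uniq: "z = z'" if "(x, y, w, z) \<in> E" "(x, y, w, z') \<in> E" for x y w z z'
  proof (rule ccontr)
    assume "z \<noteq> z'"
    then have "\<exists>t. pattern a b c t" using witness[OF that(1)] that(2) by force
    then show False using v by (simp add: pattern_def)
  qed
  have "card S = card Q"
    unfolding Q_def by (rule card_image[symmetric]) (use uniq in \<open>auto simp: inj_on_def SE\<close>)
  moreover have "2 ^ k * card Q \<le> n\<^sup>2"
  proof (rule card_C4_free[OF X X _ _ n_large])
    show "Q \<subseteq> X \<times> X" using EX by (auto simp: Q_def S_def)
    fix x x' y y'
    assume q: "(x, y) \<in> Q" "(x', y) \<in> Q" "(x, y') \<in> Q" "(x', y') \<in> Q" and y: "y \<noteq> y'"
    obtain z1 z2 z3 z4 where E: "(x, y, w0, z1) \<in> E" "(x', y, w0, z2) \<in> E" "(x, y', w0, z3) \<in> E"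
      "(x', y', w0, z4) \<in> E" using q by (auto simp: Q_def SE)
    obtain \<phi> where \<phi>: "\<phi> x = 1" "\<phi> y = 0" "\<phi> w0 = 0"
      "\<And>x' y' w' z'. (x', y', w', z') \<in> E \<Longrightarrow> (x', y', w', z') \<noteq> (x, y, w0, z1) \<Longrightarrow>
           pattern (\<phi> x') (\<phi> y') (\<phi> w') (\<phi> z')"
      using witness[OF E(1)] v by auto
    show "x = x'"
    proof (rule ccontr)
      assume x: "x \<noteq> x'"
      have "\<phi> x' = 0" using \<phi>(4)[OF E(2)] \<phi>(2,3) x by (simp add: pattern_def)
      moreover have "\<phi> y' = 2" using \<phi>(4)[OF E(3)] \<phi>(1,3) y by (simp add: pattern_def)
      ultimately show False using \<phi>(4)[OF E(4)] \<phi>(3) x by (simp add: pattern_def)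
    qed
  qed
  ultimately show "2 ^ k * card {e\<in>E. (\<lambda>(x, y, w, z). w) e = w0} \<le> n\<^sup>2"
    by (simp add: S_def)
qed (use EX in auto)

text \<open>For fixed \<open>y\<close> the corner \<open>(x', w)\<close> forces 1 on
  \<open>x'\<close> and the corner \<open>(x, w')\<close> forces 0 on \<open>w'\<close>; the
  opposite corner then starts with 1, 0, 0, which no pattern does.\<close>

lemma card_if_C4_in_xw:
  assumes v: "a = 0" "b = 0" "c = 1"
  shows "2 ^ k * card E \<le> n ^ 3"
proof (rule card_by_slices[OF X finE, of "\<lambda>(x, y, w, z). y"])
  fix y0 assume "y0 \<in> X"
  define S where "S = {e\<in>E. (\<lambda>(x, y, w, z). y) e = y0}"
  define Q where "Q = (\<lambda>(x, y, w, z). (x, w)) ` S"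
  have SE: "(x, y, w, z) \<in> S \<longleftrightarrow> (x, y, w, z) \<in> E \<and> y = y0" for x y w z
    by (auto simp: S_def)
  have uniq: "z = z'" if "(x, y, w, z) \<in> E" "(x, y, w, z') \<in> E" for x y w z z'
  proof (rule ccontr)
    assume "z \<noteq> z'"
    then have "\<exists>t. pattern a b c t" using witness[OF that(1)] that(2) by force
    then show False using v by (simp add: pattern_def)
  qed
  have "card S = card Q"
    unfolding Q_def by (rule card_image[symmetric]) (use uniq in \<open>auto simp: inj_on_def SE\<close>)
  moreover have "2 ^ k * card Q \<le> n\<^sup>2"
  proof (rule card_C4_free[OF X X _ _ n_large])
    show "Q \<subseteq> X \<times> X" using EX by (auto simp: Q_def S_def)
    fix x x' w w'
    assume q: "(x, w) \<in> Q" "(x', w) \<in> Q" "(x, w') \<in> Q" "(x', w') \<in> Q" and w: "w \<noteq> w'"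
    obtain z1 z2 z3 z4 where E: "(x, y0, w, z1) \<in> E" "(x', y0, w, z2) \<in> E" "(x, y0, w', z3) \<in> E"
      "(x', y0, w', z4) \<in> E" using q by (auto simp: Q_def SE)
    obtain \<phi> where \<phi>: "\<phi> x = 0" "\<phi> y0 = 0" "\<phi> w = 1"
      "\<And>x' y' w' z'. (x', y', w', z') \<in> E \<Longrightarrow> (x', y', w', z') \<noteq> (x, y0, w, z1) \<Longrightarrow>
           pattern (\<phi> x') (\<phi> y') (\<phi> w') (\<phi> z')"
      using witness[OF E(1)] v by auto
    show "x = x'"
    proof (rule ccontr)
      assume x: "x \<noteq> x'"
      have "\<phi> x' = 1" using \<phi>(4)[OF E(2)] \<phi>(2,3) x by (simp add: pattern_def)
      moreover have "\<phi> w' = 0" using \<phi>(4)[OF E(3)] \<phi>(1,2) w by (simp add: pattern_def)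
      ultimately show False using \<phi>(4)[OF E(4)] \<phi>(2) x by (simp add: pattern_def)
    qed
  qed
  ultimately show "2 ^ k * card {e\<in>E. (\<lambda>(x, y, w, z). y) e = y0} \<le> n\<^sup>2"
    by (simp add: S_def)
qed (use EX in auto)

text \<open>Within a slice of fixed last coordinate, two satisfied constraints, one sharing \<open>x\<close> and the
  other sharing \<open>w\<close> with the violated one, would force the values 1 and 2 on a common \<open>y'\<close>.\<close>

lemma card_if_all_zero:
  assumes v: "a = 0" "b = 0" "c = 0" "d = 0"
  shows "2 ^ k * card E \<le> n ^ 3"
proof (rule card_by_slices[OF X finE, of "\<lambda>(x, y, w, z). z"])
  fix z0 assume "z0 \<in> X"
  define F where "F = {(x, y, w). (x, y, w, z0) \<in> E}"
  have F: "(x, y, w) \<in> F \<longleftrightarrow> (x, y, w, z0) \<in> E" for x y w by (simp add: F_def)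
  have "{e\<in>E. (\<lambda>(x, y, w, z). z) e = z0} = (\<lambda>(x, y, w). (x, y, w, z0)) ` F"
    by (auto simp: F_def image_iff)
  then have "card {e\<in>E. (\<lambda>(x, y, w, z). z) e = z0} = card F"
    by (simp add: card_image inj_on_def split_def prod_eq_iff)
  moreover have "2 ^ k * card F \<le> n\<^sup>2"
  proof (rule ruzsa_szemeredi[OF X _ _ _ _ _ n])
    have wit: "\<exists>\<phi>. \<phi> x = 0 \<and> \<phi> y = 0 \<and> \<phi> w = 0 \<and> \<phi> z0 = 0 \<and>
        (\<forall>x' y' w'. (x', y', w') \<in> F \<longrightarrow> (x', y', w') \<noteq> (x, y, w) \<longrightarrow> pattern (\<phi> x') (\<phi> y') (\<phi> w') 0)"
      if "(x, y, w) \<in> F" for x y w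
    proof -
      have E: "(x, y, w, z0) \<in> E" using that by (simp add: F)
      obtain \<phi> where "\<phi> x = 0" "\<phi> y = 0" "\<phi> w = 0" "\<phi> z0 = 0"
        "\<And>x' y' w' z'. (x', y', w', z') \<in> E \<Longrightarrow> (x', y', w', z') \<noteq> (x, y, w, z0) \<Longrightarrow>
           pattern (\<phi> x') (\<phi> y') (\<phi> w') (\<phi> z')"
        using witness[OF E] v by auto
      then show ?thesis unfolding F by (intro exI[of _ \<phi>]) fastforce
    qed
    show "F \<subseteq> X \<times> X \<times> X" using EX by (auto simp: F_def)
    \<comment> \<open>Linearity: a pattern with last value 0 never has two zeros among its first
      three values.\<close>
    show "w = w'" if "(x, y, w) \<in> F" "(x, y, w') \<in> F" for x y w w'
    proof (rule ccontr)
      assume "\<not> ?thesis"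
      then have "(\<exists>t. pattern 0 0 t 0) \<or> (\<exists>t. pattern 0 t 0 0) \<or> (\<exists>t. pattern t 0 0 0)"
        using wit[OF that(1)] that(2) by force
      then show False by (auto simp: pattern_def)
    qed
    show "y = y'" if "(x, y, w) \<in> F" "(x, y', w) \<in> F" for x y y' w
    proof (rule ccontr)
      assume "\<not> ?thesis"
      then have "(\<exists>t. pattern 0 0 t 0) \<or> (\<exists>t. pattern 0 t 0 0) \<or> (\<exists>t. pattern t 0 0 0)"
        using wit[OF that(1)] that(2) by force
      then show False by (auto simp: pattern_def)
    qed
    show "x = x'" if "(x, y, w) \<in> F" "(x', y, w) \<in> F" for x x' y w
    proof (rule ccontr)
      assume "\<not> ?thesis"
      then have "(\<exists>t. pattern 0 0 t 0) \<or> (\<exists>t. pattern 0 t 0 0) \<or> (\<exists>t. pattern t 0 0 0)"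
        using wit[OF that(1)] that(2) by force
      then show False by (auto simp: pattern_def)
    qed
    show "y = y'" if t: "(x, y, w) \<in> F" "(x, y', w') \<in> F" "(x', y', w) \<in> F" for x y w x' y' w'
    proof (rule ccontr)
      assume y: "y \<noteq> y'"
      obtain \<phi> where \<phi>: "\<phi> x = 0" "\<phi> y = 0" "\<phi> w = 0"
        "\<And>x' y' w'. (x', y', w') \<in> F \<Longrightarrow> (x', y', w') \<noteq> (x, y, w) \<Longrightarrow> pattern (\<phi> x') (\<phi> y') (\<phi> w') 0"
        using wit[OF t(1)] by auto
      have "\<phi> y' = 1" using \<phi>(4)[OF t(2)] \<phi>(1) y by (simp add: pattern_def)
      then show False using \<phi>(4)[OF t(3)] \<phi>(3) y by (simp add: pattern_def)
    qed
  qed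
  ultimately show "2 ^ k * card {e\<in>E. (\<lambda>(x, y, w, z). z) e = z0} \<le> n\<^sup>2" by simp
qed (use EX in auto)

text \<open>In the first three cases one or two values already exclude every pattern. The violating
  tuples that remain start with 1, 0, 0 or with 0, 0, 1, or are zero throughout.\<close>

lemma card_bound:
  assumes "a \<le> 2" "b \<le> 2" "c \<le> 2" "d \<le> 2" and viol: "\<not> pattern a b c d"
  shows "2 ^ k * card E \<le> n ^ 3"
proof -
  consider "a = 2 \<or> a = 0 \<and> b = 2" | "c = 2 \<or> b = 1 \<and> c = 0" | "d = 2"
    | "a = 1" "b = 0" "c = 0" | "a = 0" "b = 0" "c = 1" | "a = 0" "b = 0" "c = 0" "d = 0"
    using assms by (force simp: pattern_def le_Suc_eq numeral_2_eq_2)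
  then show ?thesis
  proof cases
    case 1
    then show ?thesis by (intro card_if_no_xy) (auto simp: pattern_def)
  next
    case 2
    then show ?thesis by (intro card_if_no_yw) (auto simp: pattern_def)
  next
    case 3
    then show ?thesis by (intro card_if_no_xz) (auto simp: pattern_def)
  next
    case 4
    then show ?thesis by (rule card_if_C4_in_xy)
  next
    case 5
    then show ?thesis by (rule card_if_C4_in_xw)
  next
    case 6
    then show ?thesis by (rule card_if_all_zero)
  qed
qed

end

section \<open>Chain length and conclusion\<close>

lemma nlists_4_eq:
  assumes "S \<in> nlists 4 V"
  shows "S = [S ! 0, S ! 1, S ! 2, S ! 3]" "S ! 0 \<in> V" "S ! 1 \<in> V" "S ! 2 \<in> V" "S ! 3 \<in> V"
proof -
  have "length S = 4" "set S \<subseteq> V" using assms unfolding nlists_def by auto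
  then show "S = [S ! 0, S ! 1, S ! 2, S ! 3]" "S ! 0 \<in> V" "S ! 1 \<in> V" "S ! 2 \<in> V" "S ! 3 \<in> V"
    by (auto simp: list_eq_iff_nth_eq nth_Cons less_Suc_eq numeral_eq_Suc split: nat.splits)
qed

lemma satisfies_pattern_rel:
  assumes S: "S \<in> nlists 4 V" and \<phi>: "\<phi> \<in> V \<rightarrow> {0, 1, 2}"
  shows "satisfies pattern_rel \<phi> S \<longleftrightarrow> pattern (\<phi> (S ! 0)) (\<phi> (S ! 1)) (\<phi> (S ! 2)) (\<phi> (S ! 3))"
proof -
  have len: "length S = 4" "set S \<subseteq> V" using S unfolding nlists_def by auto
  have "\<phi> ` set S \<subseteq> {0, 1, 2}"
    by (rule image_subsetI) (rule Pi_mem[OF \<phi> subsetD[OF len(2)]])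
  then have "map \<phi> S \<in> nlists 4 {0, 1, 2}"
    using len(1) by (intro nlistsI) (simp_all only: length_map set_map)
  then show ?thesis using len by (simp add: satisfies_def pattern_rel_def)
qed

text \<open>There are \<open>81 = 3 ^ 4\<close> possible values of a witness on its own constraint.
  Each class keeps its witnesses and is therefore a \<open>uniform_instance\<close>.\<close>

lemma card_non_redundant_le:
  assumes nr: "non_redundant {0, 1, 2} 4 pattern_rel {1..n} C"
    and n: "1732 * k + 6966 < log_star (real n)"
  shows "2 ^ k * card C \<le> 81 * n ^ 3"
proof -
  define X where "X = {1..n}"
  have CX: "C \<subseteq> nlists 4 X" using nr by (simp add: non_redundant_def csp_instance_def X_def)
  have finC: "finite C" using CX finite_nlists[of X 4] finite_subset by (auto simp: X_def)
  have "\<forall>S\<in>C. \<exists>\<phi>. \<phi> \<in> X \<rightarrow> {0, 1, 2} \<and> \<not> satisfies pattern_rel \<phi> S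
      \<and> (\<forall>T\<in>C. T \<noteq> S \<longrightarrow> satisfies pattern_rel \<phi> T)"
    using nr unfolding non_redundant_def X_def[symmetric] Bex_def by (elim conjE)
  from bchoice[OF this] obtain \<Phi> where "\<forall>S\<in>C. \<Phi> S \<in> X \<rightarrow> {0, 1, 2} \<and> \<not> satisfies pattern_rel (\<Phi> S) S
      \<and> (\<forall>T\<in>C. T \<noteq> S \<longrightarrow> satisfies pattern_rel (\<Phi> S) T)" ..
  note \<Phi>0 = bspec[OF this]
  have sat: "satisfies pattern_rel (\<Phi> S) T \<longleftrightarrow> pattern (\<Phi> S (T ! 0)) (\<Phi> S (T ! 1)) (\<Phi> S (T ! 2)) (\<Phi> S (T ! 3))"
    if "S \<in> C" "T \<in> C" for S T
    using satisfies_pattern_rel[OF subsetD[OF CX that(2)] conjunct1[OF \<Phi>0[OF that(1)]]] .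
  have \<Phi>V: "\<Phi> S \<in> X \<rightarrow> {0, 1, 2}" if "S \<in> C" for S
    by (rule conjunct1[OF \<Phi>0[OF that]])
  have \<Phi>viol: "\<not> pattern (\<Phi> S (S ! 0)) (\<Phi> S (S ! 1)) (\<Phi> S (S ! 2)) (\<Phi> S (S ! 3))" if "S \<in> C" for S
    using \<Phi>0[OF that] unfolding sat[OF that that] by (elim conjE)
  have \<Phi>sat: "pattern (\<Phi> S (T ! 0)) (\<Phi> S (T ! 1)) (\<Phi> S (T ! 2)) (\<Phi> S (T ! 3))"
    if "S \<in> C" "T \<in> C" "T \<noteq> S" for S T
    using conjunct2[OF conjunct2[OF \<Phi>0[OF that(1)]]] that(2,3) sat[OF that(1,2)] by blast
  define D :: "nat set" where "D = {0, 1, 2}"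
  define val where "val = (\<lambda>S. (\<Phi> S (S ! 0), \<Phi> S (S ! 1), \<Phi> S (S ! 2), \<Phi> S (S ! 3)))"
  have valD: "val S \<in> D \<times> D \<times> D \<times> D" if "S \<in> C" for S
  proof -
    note nlists_4_eq(2-5)[OF subsetD[OF CX that]]
    moreover have "\<Phi> S v \<in> D" if "v \<in> X" for v
      using Pi_mem[OF \<Phi>V[OF \<open>S \<in> C\<close>] that] by (simp only: D_def)
    ultimately show ?thesis by (simp only: val_def mem_Sigma_iff)
  qed
  let ?q = "\<lambda>S. (S ! 0, S ! 1, S ! 2, S ! 3)"
  have injq: "inj_on ?q C"
  proof (rule inj_onI)
    fix S T assume "S \<in> C" "T \<in> C" "?q S = ?q T"
    then show "S = T" using nlists_4_eq(1)[OF subsetD[OF CX]] by (metis prod.inject)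
  qed
  have bound: "2 ^ k * card {S\<in>C. val S = (a, b, c, d)} \<le> n ^ 3"
    if abcd: "(a, b, c, d) \<in> D \<times> D \<times> D \<times> D" for a b c d
  proof (cases "pattern a b c d")
    case True
    then have none: "{S\<in>C. val S = (a, b, c, d)} = {}" using \<Phi>viol by (auto simp: val_def)
    show ?thesis unfolding none by simp
  next
    case False
    define E where "E = ?q ` {S\<in>C. val S = (a, b, c, d)}"
    interpret uniform_instance X n E a b c d k
    proof
      show "finite X" "card X = n" by (simp_all add: X_def)
      show "E \<subseteq> X \<times> X \<times> X \<times> X" using CX nlists_4_eq[of _ X] by (auto simp: E_def)
      show "1732 * k + 6966 < log_star (real n)" by (rule n)
      fix x y w z assume "(x, y, w, z) \<in> E"
      then obtain S where S: "S \<in> C" "val S = (a, b, c, d)" "(x, y, w, z) = ?q S" by (auto simp: E_def)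
      have "pattern (\<Phi> S x') (\<Phi> S y') (\<Phi> S w') (\<Phi> S z')"
        if T: "(x', y', w', z') \<in> E" "(x', y', w', z') \<noteq> (x, y, w, z)" for x' y' w' z'
      proof -
        obtain T where T: "T \<in> C" "(x', y', w', z') = ?q T" "T \<noteq> S"
          using T S(3) by (auto simp: E_def)
        then show ?thesis using \<Phi>sat[OF S(1) T(1,3)] by simp
      qed
      then show "\<exists>\<phi>. \<phi> x = a \<and> \<phi> y = b \<and> \<phi> w = c \<and> \<phi> z = d \<and>
        (\<forall>x' y' w' z'. (x', y', w', z') \<in> E \<longrightarrow> (x', y', w', z') \<noteq> (x, y, w, z) \<longrightarrow>
           pattern (\<phi> x') (\<phi> y') (\<phi> w') (\<phi> z'))"
        using S(2,3) by (intro exI[of _ "\<Phi> S"]) (simp add: val_def)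
    qed
    have "card {S\<in>C. val S = (a, b, c, d)} = card E"
      unfolding E_def by (rule card_image[symmetric]) (rule inj_on_subset[OF injq], auto)
    moreover have "2 ^ k * card E \<le> n ^ 3"
      using abcd False by (intro card_bound) (auto simp: D_def)
    ultimately show ?thesis by simp
  qed
  have "C = (\<Union>v\<in>D \<times> D \<times> D \<times> D. {S\<in>C. val S = v})" using valD by auto
  moreover have finD: "finite (D \<times> D \<times> D \<times> D)" by (simp add: D_def)
  ultimately have "card C \<le> (\<Sum>v\<in>D \<times> D \<times> D \<times> D. card {S\<in>C. val S = v})"
    using card_UN_le[OF finD, of "\<lambda>v. {S\<in>C. val S = v}"] by argo
  then have "2 ^ k * card C \<le> (\<Sum>v\<in>D \<times> D \<times> D \<times> D. 2 ^ k * card {S\<in>C. val S = v})"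
    by (simp add: sum_distrib_left[symmetric])
  also have "\<dots> \<le> (\<Sum>v\<in>D \<times> D \<times> D \<times> D. n ^ 3)"
    using bound by (intro sum_mono) auto
  also have "\<dots> = 81 * n ^ 3" by (simp add: D_def card_cartesian_product)
  finally show ?thesis .
qed

text \<open>The coordinates get disjoint blocks of \<open>m\<close>, \<open>m\<close>,
  \<open>2 * m\<close> and \<open>m\<close> variables, the third being longer because it holds sums;
  so a witness can be chosen block by block. Reading \<open>i\<close> in base \<open>m\<close> makes
  the list lexicographic. An earlier constraint with smaller \<open>px\<close> has third value 1, or
  an equal sum and hence larger \<open>py\<close>, which gives 1, 2, 0. With equal \<open>px\<close>
  and smaller \<open>py\<close> it shows 0, 1, 1, and otherwise 0, 0, 0, 1.\<close>

lemma chain_witness_pattern_rel: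
  assumes m: "5 * m \<le> n"
  shows "\<exists>Ss. chain_witness {0, 1, 2} 4 pattern_rel {1..n} Ss \<and> length Ss = m ^ 3"
proof -
  define px where "px = (\<lambda>i. i div (m * m))"
  define py where "py = (\<lambda>i. i div m mod m)"
  define pz where "pz = (\<lambda>i. i mod m)"
  define f where "f = (\<lambda>i. [1 + px i, 1 + m + py i, 1 + 2 * m + (px i + py i), 1 + 4 * m + pz i])"
  have range: "px i < m" "py i < m" "pz i < m" if "i < m ^ 3" for i
  proof -
    have "m > 0" using that by (intro gr0I) simp
    moreover have "i < m * (m * m)" using that by (simp only: power3_eq_cube mult.assoc)
    ultimately show "px i < m" "py i < m" "pz i < m"
      unfolding px_def py_def pz_def by (simp_all only: less_mult_imp_div_less mod_less_divisor)
  qed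
  have row: "l div m = px l * m + py l" for l
    by (simp add: px_def py_def div_mult2_eq)
  have entry: "l = (px l * m + py l) * m + pz l" for l
    unfolding row[symmetric] pz_def by simp
  have lex: "px j < px i \<or> px j = px i \<and> py j < py i \<or> px j = px i \<and> py j = py i \<and> pz j \<noteq> pz i"
    if ji: "j < i" for i j
  proof -
    have "px j \<le> px i" using ji by (simp add: px_def div_le_mono)
    moreover have "py j \<le> py i" if "px j = px i"
    proof -
      have "j div m \<le> i div m" using ji by (simp add: div_le_mono)
      then show ?thesis using row[of i] row[of j] that by simp
    qed
    moreover have "pz j \<noteq> pz i" if "px j = px i" "py j = py i"
      using entry[of i] entry[of j] that ji by (intro notI) simp
    ultimately show ?thesis by (cases "px j = px i"; cases "py j = py i") auto
  qed
  let ?Ss = "map f [0..<m ^ 3]"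
  have fV: "f i \<in> nlists 4 {1..n}" if "i < m ^ 3" for i
    by (rule nlistsI) (use range[OF that] m in \<open>simp_all add: f_def\<close>)
  have "chain_witness {0, 1, 2} 4 pattern_rel {1..n} ?Ss"
    unfolding chain_witness_def csp_instance_def
  proof (intro conjI allI impI)
    show "finite {1..n}" by simp
    show "set ?Ss \<subseteq> nlists 4 {1..n}" using fV by auto
    fix i assume "i < length ?Ss"
    then have i: "i < m ^ 3" by simp
    define \<phi> :: "nat \<Rightarrow> nat" where "\<phi> = (\<lambda>v.
      if v \<le> m then (if v = 1 + px i then 0 else 1)
      else if v \<le> 2 * m then (if v = 1 + m + py i then 0 else if v < 1 + m + py i then 1 else 2)
      else if v \<le> 4 * m then (if v = 1 + 2 * m + (px i + py i) then 0 else 1)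
      else (if v = 1 + 4 * m + pz i then 0 else 1))"
    have \<phi>V: "\<phi> \<in> {1..n} \<rightarrow> {0, 1, 2}" by (rule Pi_I) (simp add: \<phi>_def)
    have vals: "\<phi> (f j ! 0) = (if px j = px i then 0 else 1)"
      "\<phi> (f j ! 1) = (if py j = py i then 0 else if py j < py i then 1 else 2)"
      "\<phi> (f j ! 2) = (if px j + py j = px i + py i then 0 else 1)"
      "\<phi> (f j ! 3) = (if pz j = pz i then 0 else 1)" if "j < m ^ 3" for j
      using range[OF that] by (auto simp: \<phi>_def f_def)
    show "\<exists>\<phi>\<in>{1..n} \<rightarrow> {0, 1, 2}. \<not> satisfies pattern_rel \<phi> (?Ss ! i)
        \<and> (\<forall>j<i. satisfies pattern_rel \<phi> (?Ss ! j))"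
    proof (intro bexI[OF _ \<phi>V] conjI allI impI)
      show "\<not> satisfies pattern_rel \<phi> (?Ss ! i)"
        using i satisfies_pattern_rel[OF fV[OF i] \<phi>V] vals[OF i] by (simp add: pattern_def)
      fix j assume j: "j < i"
      then have jm: "j < m ^ 3" using i by simp
      have "pattern (\<phi> (f j ! 0)) (\<phi> (f j ! 1)) (\<phi> (f j ! 2)) (\<phi> (f j ! 3))"
        unfolding vals[OF jm] using lex[OF j] by (auto simp: pattern_def)
      then show "satisfies pattern_rel \<phi> (?Ss ! j)"
        using jm satisfies_pattern_rel[OF fV[OF jm] \<phi>V] by simp
    qed
  qed
  then show ?thesis by (intro exI[of _ ?Ss]) simp
qed

section \<open>Asymptotic bounds for chain length and non-redundancy\<close>

lemma CL_pattern_rel_ge: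
  assumes "5 \<le> n"
  shows "real n ^ 3 / 1000 \<le> real (CL {0, 1, 2} 4 pattern_rel n)"
proof -
  define m where "m = n div 5"
  obtain Ss where "chain_witness {0, 1, 2} 4 pattern_rel {1..n} Ss" "length Ss = m ^ 3"
    using chain_witness_pattern_rel[of m n] unfolding m_def by fastforce
  then have "m ^ 3 \<in> {length Ss | Ss. chain_witness {0, 1, 2} 4 pattern_rel {1..n} Ss}"
    by (intro CollectI exI[of _ Ss] conjI) (simp_all only:)
  then have "m ^ 3 \<le> CL {0, 1, 2} 4 pattern_rel n"
    unfolding CL_def by (rule Max_ge[OF CL_set_finite])
  then have "real m ^ 3 \<le> real (CL {0, 1, 2} 4 pattern_rel n)"
    using of_nat_mono[of "m ^ 3" "CL {0, 1, 2} 4 pattern_rel n", where 'a=real] by simp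
  moreover have "n \<le> 10 * m" using assms unfolding m_def by presburger
  then have "real n / 10 \<le> real m" by linarith
  then have "(real n / 10) ^ 3 \<le> real m ^ 3" by (intro power_mono) auto
  ultimately have "(real n / 10) ^ 3 \<le> real (CL {0, 1, 2} 4 pattern_rel n)" by linarith
  then show ?thesis by (simp add: power_divide)
qed

lemma log_star_unbounded: "\<exists>n::nat. m \<le> log_star (real n)"
proof (induction m)
  case 0
  show ?case by simp
next
  case (Suc m)
  then obtain n :: nat where "m \<le> log_star (real n)" by blast
  also have "\<dots> \<le> log_star (real (Suc n))" by (rule log_star_mono) simp
  finally have "m \<le> log_star (real (Suc n))" .
  moreover have "log_star (2 ^ Suc n) = Suc (log_star (log 2 (2 ^ Suc n)))"
    by (rule log_star_step) (rule one_less_power, auto)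
  moreover have "log 2 (2 ^ Suc n) = real (Suc n)" by (rule log_pow_cancel) auto
  ultimately have "Suc m \<le> log_star (real (2 ^ Suc n))"
    by (simp only: of_nat_power of_nat_numeral Suc_le_mono)
  then show ?case by blast
qed

lemma NRD_pattern_rel_le:
  assumes L: "40000 \<le> log_star (real n)"
  shows "real (NRD {0, 1, 2} 4 pattern_rel n) \<le> real n ^ 3 / 2 powr (1 / 4000 * real (log_star (real n)))"
proof -
  define L where "L = log_star (real n)"
  \<comment> \<open>This is the largest \<open>k\<close> that \<open>card_non_redundant_le\<close>
    admits. With 81 bounded by \<open>2 ^ 7\<close>, the final exponent is \<open>7 - k\<close>, at
    most \<open>7 - (L - 8699) / 1732\<close>, and this is below \<open>- L / 4000\<close> once
    \<open>L\<close> is at least 40000.\<close>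
  define k where "k = (L - 6967) div 1732"
  have k: "1732 * k + 6966 < log_star (real n)" "L \<le> 1732 * k + 8699"
    using L unfolding k_def L_def[symmetric] by linarith+
  have "NRD {0, 1, 2} 4 pattern_rel n \<in> {card C |C. non_redundant {0, 1, 2} 4 pattern_rel {1..n} C}"
    unfolding NRD_def by (intro Max_in NRD_set_finite NRD_set_nonempty)
  then obtain C where C: "non_redundant {0, 1, 2} 4 pattern_rel {1..n} C"
    "NRD {0, 1, 2} 4 pattern_rel n = card C" by blast
  have "2 ^ k * card C \<le> 81 * n ^ 3" by (rule card_non_redundant_le[OF C(1) k(1)])
  then have "2 ^ k * real (card C) \<le> 81 * real n ^ 3"
    using of_nat_mono[of "2 ^ k * card C" "81 * n ^ 3", where 'a=real] by simp
  also have "\<dots> \<le> 2 ^ 7 * real n ^ 3" by (intro mult_right_mono) auto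
  finally have "2 powr real k * real (card C) \<le> 2 powr 7 * real n ^ 3"
    by (simp add: powr_realpow)
  then have "real (card C) \<le> 2 powr 7 / 2 powr real k * real n ^ 3"
    by (simp add: field_simps)
  also have "2 powr 7 / 2 powr real k = (2::real) powr (7 - real k)" by (simp add: powr_diff)
  also have "\<dots> \<le> 2 powr (- (1 / 4000 * real L))"
    using k(2) L unfolding L_def[symmetric] by (intro powr_mono) auto
  also have "\<dots> = 1 / 2 powr (1 / 4000 * real L)" by (simp add: powr_minus_divide)
  finally show ?thesis
    unfolding C(2) L_def by (simp add: mult_right_mono)
qed

theorem theorem1p1:
  shows "\<exists>(D :: nat set) (R :: nat list set).
           card D = 3 \<and> R \<subseteq> nlists 4 D \<and>
           (\<exists>(c1 :: real) (c2 :: real) (n0 :: nat). c1 > 0 \<and> c2 > 0 \<and>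
             (\<forall>n\<ge>n0. real (CL D 4 R n) \<ge> c1 * real n ^ 3 \<and>
                     real (NRD D 4 R n) \<le> real n ^ 3 / 2 powr (c2 * real (log_star (real n)))))"
proof -
  obtain n1 :: nat where n1: "40000 \<le> log_star (real n1)" using log_star_unbounded by blast
  have bounds: "1 / 1000 * real n ^ 3 \<le> real (CL {0, 1, 2} 4 pattern_rel n)"
    "real (NRD {0, 1, 2} 4 pattern_rel n) \<le> real n ^ 3 / 2 powr (1 / 4000 * real (log_star (real n)))"
    if "max 5 n1 \<le> n" for n
  proof -
    have n: "5 \<le> n" "n1 \<le> n" using that by simp_all
    show "1 / 1000 * real n ^ 3 \<le> real (CL {0, 1, 2} 4 pattern_rel n)"
      using CL_pattern_rel_ge[OF n(1)] by simp
    have "log_star (real n1) \<le> log_star (real n)" using n(2) by (intro log_star_mono) simp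
    with n1 show "real (NRD {0, 1, 2} 4 pattern_rel n)
        \<le> real n ^ 3 / 2 powr (1 / 4000 * real (log_star (real n)))"
      by (intro NRD_pattern_rel_le) (rule le_trans)
  qed
  have sub: "pattern_rel \<subseteq> nlists 4 {0, 1, 2}"
    unfolding pattern_rel_def by (rule Collect_restrict)
  show ?thesis
    by (rule exI[of _ "{0, 1, 2}"], rule exI[of _ pattern_rel], intro conjI,
        simp, rule sub, rule exI[of _ "1 / 1000"], rule exI[of _ "1 / 4000"], rule exI[of _ "max 5 n1"],
        intro conjI allI impI bounds, simp_all only: zero_less_divide_1_iff zero_less_numeral)
qed

end
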